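(* Let $A_0,A_1,A_2,B_0,B_1,B_2,B_3,B_4$ be smooth real functions of $(x,y)$ on an open region, and consider the third order ordinary differential equation for $y=y(x)$ $$y'''+(A_2y'^2-A_1y'+A_0)y''+B_4y'^4-B_3y'^3+B_2y'^2-B_1y'+B_0=0. \qquad (\ast)$$ Suppose that the functions $c,g,h$ are given by $$c=\frac{A_2}{3},\qquad g=\frac{A_1}{2},\qquad h=A_0,$$ with $c\neq 0$, that the constraints $$B_4=\frac{A_{2y}}{3},\qquad B_3=\frac{A_{1y}}{2}-\frac{A_{2x}}{3},\qquad B_2=A_{0y}-\frac{A_{1x}}{2}$$ hold, and that $d$ is a function of $(x,y)$ satisfying $$d=-\int B_0\,dx+k(y)=\int (B_1+A_{0x})\,dy+l(x)$$ for some functions $k(y)$ and $l(x)$ (which determines $d$ up to an additive constant). Suppose further that, for a suitable choice of this constant, there are functions $a,b,e,f$ of $(x,y)$ with $h=a-2e$ and $g=f-2b$ such that the linearizability criteria $$3b_x+2g_x+h_y+3be-3cd=0,\qquad b_y-c_x+b^2+bg+ch+ce=0,$$ $$d_y-e_x-bd-dg-e^2-eh=0,\qquad 3e_y+2h_y+g_x+3be-3cd=0$$ are satisfied, and such that the Christoffel symbols determined by $a,b,c,d,e,f$ are consistent with metric coefficients, i.e. there is a non-singular symmetric metric with $g_{11}=p$, $g_{12}=g_{21}=q$, $g_{22}=r$ satisfying $$p_x=-2(ap+dq),\quad q_x=-bp-(a+e)q-dr,\quad r_x=-2(bq+er),$$ $$p_y=-2(bp+eq),\quad q_y=-cp-(b+f)q-er,\quad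 r_y=-2(cq+fr).$$ Then equation $(\ast)$ is linearizable.
   Context: Subscripts $x,y$ denote partial derivatives (e.g. $A_{2y}=\partial A_2/\partial y$); primes denote derivatives with respect to $x$; functions are smooth and all statements are local. The equations considered are obtained by differentiating the cubically semi-linear second order equation $$y''+c\,y'^3-g\,y'^2+h\,y'-d=0, \qquad (\ast\ast)$$ with $c,g,h,d$ functions of $(x,y)$. This equation is the projection (elimination of the geodetic parameter) of the quadratically semi-linear system of geodesic-type equations $$x''=a x'^2+2b x'y'+c y'^2,\qquad y''=d x'^2+2e x'y'+f y'^2,$$ in which primes temporarily denote differentiation with respect to the parameter and $a,\dots,f$ are functions of $(x,y)$, with $h=a-2e$, $g=f-2b$. The corresponding Christoffel symbols are $$\Gamma^1_{11}=-a,\ \Gamma^1_{12}=-b,\ \Gamma^1_{22}=-c,\ \Gamma^2_{11}=-d,\ \Gamma^2_{12}=-e,\ \Gamma^2_{22}=-f.$$ Differentiating $(\ast\ast)$ with respect to $x$ gives $$y'''+(3cy'^2-2gy'+h)y''+c_yy'^4+(c_x-g_y)y'^3-(g_x-h_y)y'^2+(h_x-d_y)y'-d_x=0.$$ "Linearizable" for the third order equation $(\ast)$ means: $(\ast)$ is the equation obtained from $(\ast\ast)$ by differentiating it with respect to $x$ (so every solution of $(\ast\ast)$ is a solution of $(\ast)$), and the second order equation $(\ast\ast)$ is transformable to a linear second order equation by a locally invertible point transformation $u=u(x,y)$, $v=v(x,y)$. In particular only two, not necessarily three, arbitrary constants are guaranteed in the resulting solutions of $(\ast)$. *)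

theory Defs
  imports "HOL-Analysis.Analysis"
begin

text \<open>On an open set \<open>S\<close>, \<open>Ck_on k S f\<close> says that \<open>f\<close> is \<open>k\<close> times continuously differentiable.\<close>

primrec Ck_on :: "nat \<Rightarrow> 'a::euclidean_space set \<Rightarrow> ('a \<Rightarrow> real) \<Rightarrow> bool" where
  "Ck_on 0 S f \<longleftrightarrow> continuous_on S f"
| "Ck_on (Suc k) S f \<longleftrightarrow>
     (\<forall>z\<in>S. f differentiable (at z)) \<and>
     (\<forall>i\<in>Basis. Ck_on k S (\<lambda>z. frechet_derivative f (at z) i))"

definition smooth_on :: "'a::euclidean_space set \<Rightarrow> ('a \<Rightarrow> real) \<Rightarrow> bool" where
  "smooth_on S f \<longleftrightarrow> (\<forall>k. Ck_on k S f)"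

definition dx :: "(real \<times> real \<Rightarrow> real) \<Rightarrow> real \<times> real \<Rightarrow> real" where
  "dx f z = deriv (\<lambda>t. f (t, snd z)) (fst z)"

definition dy :: "(real \<times> real \<Rightarrow> real) \<Rightarrow> real \<times> real \<Rightarrow> real" where
  "dy f z = deriv (\<lambda>t. f (fst z, t)) (snd z)"

text \<open>\<open>P\<close> is an indefinite integral \<open>\<integral> f dx\<close> (resp. \<open>\<integral> f dy\<close>) on \<open>R\<close>.\<close>

definition antiderivative_x ::
    "(real \<times> real) set \<Rightarrow> (real \<times> real \<Rightarrow> real) \<Rightarrow> (real \<times> real \<Rightarrow> real) \<Rightarrow> bool" where
  "antiderivative_x R f P \<longleftrightarrow>
     (\<forall>(x, y)\<in>R. ((\<lambda>t. P (t, y)) has_real_derivative f (x, y)) (at x))"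

definition antiderivative_y ::
    "(real \<times> real) set \<Rightarrow> (real \<times> real \<Rightarrow> real) \<Rightarrow> (real \<times> real \<Rightarrow> real) \<Rightarrow> bool" where
  "antiderivative_y R f P \<longleftrightarrow>
     (\<forall>(x, y)\<in>R. ((\<lambda>t. P (x, t)) has_real_derivative f (x, y)) (at y))"

text \<open>An equation is given by its left-hand side as a function of \<open>x, y, y', y'', \<dots>\<close>;
  the right-hand side is \<open>0\<close>.\<close>

type_synonym ode2 = "real \<Rightarrow> real \<Rightarrow> real \<Rightarrow> real \<Rightarrow> real"
type_synonym ode3 = "real \<Rightarrow> real \<Rightarrow> real \<Rightarrow> real \<Rightarrow> real \<Rightarrow> real"

definition third_order_eq ::
    "(real \<times> real \<Rightarrow> real) \<Rightarrow> (real \<times> real \<Rightarrow> real) \<Rightarrow> (real \<times> real \<Rightarrow> real) \<Rightarrow>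
     (real \<times> real \<Rightarrow> real) \<Rightarrow> (real \<times> real \<Rightarrow> real) \<Rightarrow> (real \<times> real \<Rightarrow> real) \<Rightarrow>
     (real \<times> real \<Rightarrow> real) \<Rightarrow> (real \<times> real \<Rightarrow> real) \<Rightarrow> ode3" where
  "third_order_eq A0 A1 A2 B0 B1 B2 B3 B4 x y y1 y2 y3 =
     y3 + (A2 (x, y) * y1 ^ 2 - A1 (x, y) * y1 + A0 (x, y)) * y2
     + B4 (x, y) * y1 ^ 4 - B3 (x, y) * y1 ^ 3 + B2 (x, y) * y1 ^ 2
     - B1 (x, y) * y1 + B0 (x, y)"

definition cubic_eq ::
    "(real \<times> real \<Rightarrow> real) \<Rightarrow> (real \<times> real \<Rightarrow> real) \<Rightarrow> (real \<times> real \<Rightarrow> real) \<Rightarrow>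
     (real \<times> real \<Rightarrow> real) \<Rightarrow> ode2" where
  "cubic_eq c g h d x y y1 y2 =
     y2 + c (x, y) * y1 ^ 3 - g (x, y) * y1 ^ 2 + h (x, y) * y1 - d (x, y)"

definition linear_eq :: "(real \<Rightarrow> real) \<Rightarrow> (real \<Rightarrow> real) \<Rightarrow> (real \<Rightarrow> real) \<Rightarrow> ode2" where
  "linear_eq \<alpha> \<beta> \<gamma> u v v1 v2 = v2 + \<alpha> u * v1 + \<beta> u * v + \<gamma> u"

definition open_interval :: "real set \<Rightarrow> bool" where
  "open_interval I \<longleftrightarrow> open I \<and> is_interval I \<and> I \<noteq> {}"

definition times_differentiable_on :: "nat \<Rightarrow> real set \<Rightarrow> (real \<Rightarrow> real) \<Rightarrow> bool" where
  "times_differentiable_on n I y \<longleftrightarrow> (\<forall>k<n. \<forall>x\<in>I. (deriv ^^ k) y differentiable (at x))"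

definition graph_in :: "(real \<times> real) set \<Rightarrow> real set \<Rightarrow> (real \<Rightarrow> real) \<Rightarrow> bool" where
  "graph_in R I y \<longleftrightarrow> (\<forall>x\<in>I. (x, y x) \<in> R)"

definition solution2 :: "ode2 \<Rightarrow> real set \<Rightarrow> (real \<Rightarrow> real) \<Rightarrow> bool" where
  "solution2 E I y \<longleftrightarrow>
     open_interval I \<and> times_differentiable_on 2 I y \<and>
     (\<forall>x\<in>I. E x (y x) (deriv y x) (deriv (deriv y) x) = 0)"

text \<open>The left-hand side of \<open>F\<close> is the \<open>x\<close>-derivative of the left-hand side of \<open>E\<close> along
  arbitrary (three times differentiable) functions \<open>y(x)\<close>, not only along solutions.\<close>

definition obtained_by_differentiation :: "(real \<times> real) set \<Rightarrow> ode2 \<Rightarrow> ode3 \<Rightarrow> bool" where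
  "obtained_by_differentiation R E F \<longleftrightarrow>
     (\<forall>I y. open_interval I \<longrightarrow> times_differentiable_on 3 I y \<longrightarrow> graph_in R I y \<longrightarrow>
        (\<forall>x\<in>I. ((\<lambda>t. E t (y t) (deriv y t) (deriv (deriv y) t)) has_real_derivative
             F x (y x) (deriv y x) (deriv (deriv y) x) (deriv (deriv (deriv y)) x)) (at x)))"

text \<open>\<open>(x, y) \<mapsto> (U (x, y), V (x, y))\<close> is a diffeomorphism of \<open>N\<close> onto an open set.\<close>

definition point_transformation ::
    "(real \<times> real) set \<Rightarrow> (real \<times> real \<Rightarrow> real) \<Rightarrow> (real \<times> real \<Rightarrow> real) \<Rightarrow> bool" where
  "point_transformation N U V \<longleftrightarrow>
     open N \<and> smooth_on N U \<and> smooth_on N V \<and>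
     open ((\<lambda>z. (U z, V z)) ` N) \<and>
     (\<exists>X Y. smooth_on ((\<lambda>z. (U z, V z)) ` N) X \<and> smooth_on ((\<lambda>z. (U z, V z)) ` N) Y \<and>
        (\<forall>z\<in>N. (X (U z, V z), Y (U z, V z)) = z))"

text \<open>The curve \<open>y(x)\<close> is carried to the curve \<open>v = w(u)\<close>. The condition on the derivative of
  \<open>U (x, y(x))\<close> only excludes vertical tangents of the image, which is then the graph
  of a function \<open>w\<close> on the open interval \<open>{U (x, y x) | x \<in> I}\<close>.\<close>

definition transforms_to ::
    "(real \<times> real) set \<Rightarrow> (real \<times> real \<Rightarrow> real) \<Rightarrow> (real \<times> real \<Rightarrow> real) \<Rightarrow> ode2 \<Rightarrow> ode2 \<Rightarrow> bool" where
  "transforms_to N U V E E' \<longleftrightarrow>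
     (\<forall>I y w. open_interval I \<longrightarrow> times_differentiable_on 2 I y \<longrightarrow> graph_in N I y \<longrightarrow>
        (\<forall>x\<in>I. deriv (\<lambda>t. U (t, y t)) x \<noteq> 0) \<longrightarrow>
        (\<forall>x\<in>I. w (U (x, y x)) = V (x, y x)) \<longrightarrow>
        (solution2 E I y \<longleftrightarrow> solution2 E' ((\<lambda>x. U (x, y x)) ` I) w))"

text \<open>Linearizability is local: a transformation is only required near each point of \<open>R\<close>.\<close>

definition linearizable2 :: "(real \<times> real) set \<Rightarrow> ode2 \<Rightarrow> bool" where
  "linearizable2 R E \<longleftrightarrow>
     (\<forall>z\<in>R. \<exists>N U V J \<alpha> \<beta> \<gamma>.
        z \<in> N \<and> N \<subseteq> R \<and> point_transformation N U V \<and>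
        open_interval J \<and> U ` N \<subseteq> J \<and> smooth_on J \<alpha> \<and> smooth_on J \<beta> \<and> smooth_on J \<gamma> \<and>
        transforms_to N U V E (linear_eq \<alpha> \<beta> \<gamma>))"

definition linearizable3 :: "(real \<times> real) set \<Rightarrow> ode3 \<Rightarrow> bool" where
  "linearizable3 R F \<longleftrightarrow>
     (\<exists>c g h d. smooth_on R c \<and> smooth_on R g \<and> smooth_on R h \<and> smooth_on R d \<and>
        obtained_by_differentiation R (cubic_eq c g h d) F \<and>
        linearizable2 R (cubic_eq c g h d))"

definition linearizability_criteria ::
    "(real \<times> real) set \<Rightarrow>
     (real \<times> real \<Rightarrow> real) \<Rightarrow> (real \<times> real \<Rightarrow> real) \<Rightarrow> (real \<times> real \<Rightarrow> real) \<Rightarrow>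
     (real \<times> real \<Rightarrow> real) \<Rightarrow> (real \<times> real \<Rightarrow> real) \<Rightarrow> (real \<times> real \<Rightarrow> real) \<Rightarrow> bool" where
  "linearizability_criteria R b c d e g h \<longleftrightarrow>
     (\<forall>z\<in>R.
        3 * dx b z + 2 * dx g z + dy h z + 3 * b z * e z - 3 * c z * d z = 0 \<and>
        dy b z - dx c z + (b z)^2 + b z * g z + c z * h z + c z * e z = 0 \<and>
        dy d z - dx e z - b z * d z - d z * g z - (e z)^2 - e z * h z = 0 \<and>
        3 * dy e z + 2 * dy h z + dx g z + 3 * b z * e z - 3 * c z * d z = 0)"

text \<open>The metric with components \<open>g\<^sub>1\<^sub>1 = p\<close>, \<open>g\<^sub>1\<^sub>2 = g\<^sub>2\<^sub>1 = q\<close>, \<open>g\<^sub>2\<^sub>2 = r\<close> is non-singular and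
  parallel for the Christoffel symbols \<open>\<Gamma>\<^sup>1\<^sub>1\<^sub>1 = -a\<close>, \<open>\<Gamma>\<^sup>1\<^sub>1\<^sub>2 = -b\<close>, \<open>\<Gamma>\<^sup>1\<^sub>2\<^sub>2 = -c\<close>,
  \<open>\<Gamma>\<^sup>2\<^sub>1\<^sub>1 = -d\<close>, \<open>\<Gamma>\<^sup>2\<^sub>1\<^sub>2 = -e\<close>, \<open>\<Gamma>\<^sup>2\<^sub>2\<^sub>2 = -f\<close>.\<close>

definition compatible_metric ::
    "(real \<times> real) set \<Rightarrow>
     (real \<times> real \<Rightarrow> real) \<Rightarrow> (real \<times> real \<Rightarrow> real) \<Rightarrow> (real \<times> real \<Rightarrow> real) \<Rightarrow>
     (real \<times> real \<Rightarrow> real) \<Rightarrow> (real \<times> real \<Rightarrow> real) \<Rightarrow> (real \<times> real \<Rightarrow> real) \<Rightarrow>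
     (real \<times> real \<Rightarrow> real) \<Rightarrow> (real \<times> real \<Rightarrow> real) \<Rightarrow> (real \<times> real \<Rightarrow> real) \<Rightarrow> bool" where
  "compatible_metric R a b c d e f p q r \<longleftrightarrow>
     smooth_on R p \<and> smooth_on R q \<and> smooth_on R r \<and>
     (\<forall>z\<in>R.
        p z * r z - (q z)^2 \<noteq> 0 \<and>
        dx p z = - 2 * (a z * p z + d z * q z) \<and>
        dx q z = - b z * p z - (a z + e z) * q z - d z * r z \<and>
        dx r z = - 2 * (b z * q z + e z * r z) \<and>
        dy p z = - 2 * (b z * p z + e z * q z) \<and>
        dy q z = - c z * p z - (b z + f z) * q z - e z * r z \<and>
        dy r z = - 2 * (c z * q z + f z * r z))"

end

theory Submission
  imports Defs
begin

text \<open>The criteria say that the torsion-free connection with Christoffel symbols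
  \<open>-a, \<dots>, -f\<close> is flat, so near every point there should be coordinates \<open>(U, V)\<close> in which
  geodesics are straight lines; the curves solving the cubic equation are unparametrized geodesics and hence
  satisfy \<open>w'' = 0\<close>. The differentials \<open>dU, dV\<close> are parallel 1-forms. The metric allows one to find
  them by quadrature, without solving a Frobenius system: take a constant 1-form \<open>\<theta>\<close> that is not null
  at the point, normalize it and complete it to an orthogonal coframe. The covariant derivative rotates
  (or, for an indefinite metric, boosts) this coframe by a 1-form \<open>\<kappa>\<close>, which is closed because the
  curvature vanishes; rotating back by a potential of \<open>\<kappa>\<close> makes the coframe parallel. Parallel
  forms are closed since the connection is symmetric, which gives \<open>U\<close> and \<open>V\<close>.\<close>

section \<open>Gradients and smooth functions\<close>

text \<open>A quadrature is enough because the dimension is two: the covariant derivative of a unit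
  orthogonal coframe lies in the one-dimensional abelian Lie algebra of rotations or boosts, so a
  single angle function undoes it. Normalizing needs a non-null form and a metric determinant of
  constant sign, hence the sign choices at the point and the passage to a smaller neighbourhood. The
  geodesic parameter never has to be recovered. If \<open>u\<close> and \<open>v\<close> are the
  values of \<open>U\<close> and \<open>V\<close> along a graph, the second derivative of
  \<open>v\<close> with respect to \<open>u\<close> is a two by two determinant over the cube of
  \<open>u'\<close>. The coframe determinant factors out of it, and the cubic expression in
  \<open>y'\<close> and \<open>y''\<close> is left, for every twice differentiable \<open>y\<close>
  with \<open>u'\<close> nonzero. So both directions of \<open>transforms_to\<close> come at once.
  Smoothness means all orders, while square roots, potentials and inverse maps arrive with first
  derivatives only. Their gradients are expressed through smooth data and possibly the functions
  themselves, so class C^k gives class C^(k+1).\<close>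

definition has_gradient ::
    "(real \<times> real \<Rightarrow> real) \<Rightarrow> real \<Rightarrow> real \<Rightarrow> real \<times> real \<Rightarrow> bool" where
  "has_gradient f A B z \<longleftrightarrow> (f has_derivative (\<lambda>w. A * fst w + B * snd w)) (at z)"

lemma has_gradient_dx:
  assumes "has_gradient f A B z"
  shows "((\<lambda>t. f (t, snd z)) has_real_derivative A) (at (fst z))" and "dx f z = A"
proof -
  have f: "(f has_derivative (\<lambda>w. A * fst w + B * snd w)) (at (fst z, snd z))"
    using assms by (simp add: has_gradient_def)
  show "((\<lambda>t. f (t, snd z)) has_real_derivative A) (at (fst z))"
    unfolding has_field_derivative_def
    using has_derivative_compose[OF has_derivative_Pair[OF has_derivative_ident has_derivative_const], of f
        "\<lambda>w. A * fst w + B * snd w"] f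
    by simp
  then show "dx f z = A"
    by (simp add: dx_def DERIV_imp_deriv)
qed

lemma has_gradient_dy:
  assumes "has_gradient f A B z"
  shows "((\<lambda>t. f (fst z, t)) has_real_derivative B) (at (snd z))" and "dy f z = B"
proof -
  have f: "(f has_derivative (\<lambda>w. A * fst w + B * snd w)) (at (fst z, snd z))"
    using assms by (simp add: has_gradient_def)
  show "((\<lambda>t. f (fst z, t)) has_real_derivative B) (at (snd z))"
    unfolding has_field_derivative_def
    using has_derivative_compose[OF has_derivative_Pair[OF has_derivative_const has_derivative_ident], of f
        "\<lambda>w. A * fst w + B * snd w"] f
    by simp
  then show "dy f z = B"
    by (simp add: dy_def DERIV_imp_deriv)
qed

lemma linear_pair_eq:
  fixes D :: "real \<times> real \<Rightarrow> real"
  assumes "linear D"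
  shows "D = (\<lambda>w. D (1, 0) * fst w + D (0, 1) * snd w)"
proof
  fix w :: "real \<times> real"
  have "w = fst w *\<^sub>R (1, 0) + snd w *\<^sub>R (0, 1)"
    by (simp add: prod_eq_iff)
  then have "D w = D (fst w *\<^sub>R (1, 0) + snd w *\<^sub>R (0, 1))"
    by (rule arg_cong)
  also have "\<dots> = D (1, 0) * fst w + D (0, 1) * snd w"
    unfolding linear_add[OF assms] linear_scale[OF assms] by simp
  finally show "D w = D (1, 0) * fst w + D (0, 1) * snd w" .
qed

lemma differentiable_has_gradient:
  fixes f :: "real \<times> real \<Rightarrow> real"
  assumes "f differentiable (at z)"
  shows "has_gradient f (frechet_derivative f (at z) (1, 0)) (frechet_derivative f (at z) (0, 1)) z"
  using assms[unfolded frechet_derivative_works]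
  by (subst (asm) linear_pair_eq[OF linear_frechet_derivative[OF assms]]) (simp add: has_gradient_def)

lemma differentiable_gradient:
  assumes "f differentiable (at z)"
  shows "has_gradient f (dx f z) (dy f z) z"
  using differentiable_has_gradient[OF assms]
  unfolding has_gradient_dx(2)[OF differentiable_has_gradient[OF assms]]
    has_gradient_dy(2)[OF differentiable_has_gradient[OF assms]] .

lemma has_gradient_differentiable: "has_gradient f A B z \<Longrightarrow> f differentiable (at z)"
  by (auto simp: has_gradient_def differentiable_def)

lemma has_gradient_isCont: "has_gradient f A B z \<Longrightarrow> isCont f z"
  unfolding has_gradient_def by (rule has_derivative_continuous)

lemma frechet_derivative_pair:
  assumes "f differentiable (at z)"
  shows "frechet_derivative f (at z) (1, 0) = dx f z" "frechet_derivative f (at z) (0, 1) = dy f z"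
  unfolding has_gradient_dx(2)[OF differentiable_has_gradient[OF assms]]
    has_gradient_dy(2)[OF differentiable_has_gradient[OF assms]] by (rule refl)+

lemma has_gradient_cong:
  assumes "open S" "z \<in> S" "\<And>w. w \<in> S \<Longrightarrow> f w = g w" "has_gradient f A B z"
  shows "has_gradient g A B z"
  using has_derivative_transform_within_open[of f _ z UNIV S g] assms
  by (simp add: has_gradient_def)

lemma has_gradient_const: "has_gradient (\<lambda>_. k) 0 0 z"
  by (simp add: has_gradient_def)

lemma has_gradient_add:
  assumes "has_gradient f A B z" "has_gradient g A' B' z"
  shows "has_gradient (\<lambda>z. f z + g z) (A + A') (B + B') z"
  using has_derivative_add[OF assms[unfolded has_gradient_def]]
  by (simp add: has_gradient_def algebra_simps)

lemma has_gradient_diff: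
  assumes "has_gradient f A B z" "has_gradient g A' B' z"
  shows "has_gradient (\<lambda>z. f z - g z) (A - A') (B - B') z"
  using has_derivative_diff[OF assms[unfolded has_gradient_def]]
  by (simp add: has_gradient_def algebra_simps)

lemma has_gradient_mult:
  assumes "has_gradient f A B z" "has_gradient g A' B' z"
  shows "has_gradient (\<lambda>z. f z * g z) (A * g z + f z * A') (B * g z + f z * B') z"
  using has_derivative_mult[OF assms[unfolded has_gradient_def]]
  by (simp add: has_gradient_def algebra_simps)

lemma has_gradient_cmult:
  assumes "has_gradient f A B z"
  shows "has_gradient (\<lambda>z. k * f z) (k * A) (k * B) z"
  using has_gradient_mult[OF has_gradient_const assms, of k] by simp

lemma has_gradient_compose_real:
  assumes "(F has_real_derivative F') (at (f z))" "has_gradient f A B z"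
  shows "has_gradient (\<lambda>z. F (f z)) (F' * A) (F' * B) z"
  using has_derivative_compose[OF assms(2)[unfolded has_gradient_def]
      assms(1)[unfolded has_field_derivative_def]]
  by (simp add: has_gradient_def algebra_simps)

lemma has_gradient_compose:
  assumes "has_gradient F A B (f z, g z)" "has_gradient f P Q z" "has_gradient g P' Q' z"
  shows "has_gradient (\<lambda>z. F (f z, g z)) (A * P + B * P') (A * Q + B * Q') z"
  using has_derivative_compose[OF
      has_derivative_Pair[OF assms(2,3)[unfolded has_gradient_def]] assms(1)[unfolded has_gradient_def]]
  by (simp add: has_gradient_def algebra_simps)

lemma has_gradient_compose_curve:
  assumes "has_gradient F A B (x t, y t)"
    and "(x has_real_derivative x') (at t)" "(y has_real_derivative y') (at t)"
  shows "((\<lambda>t. F (x t, y t)) has_real_derivative (A * x' + B * y')) (at t)"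
proof -
  have "(\<lambda>h. A * (x' * h) + B * (y' * h)) = (*) (A * x' + B * y')"
    by (auto simp: algebra_simps)
  with has_derivative_compose[OF has_derivative_Pair[OF
      assms(2,3)[unfolded has_field_derivative_def]] assms(1)[unfolded has_gradient_def]]
  show ?thesis
    by (simp add: has_field_derivative_def)
qed

section \<open>Functions of class C^k on open subsets of the plane\<close>

lemma Ck_on_cong:
  assumes "open S" "\<And>z. z \<in> S \<Longrightarrow> f z = g z"
  shows "Ck_on k S f \<longleftrightarrow> Ck_on k S g"
  using assms(2)
proof (induction k arbitrary: f g)
  case 0
  then show ?case by (simp cong: continuous_on_cong)
next
  case (Suc k)
  have *: "(f has_derivative D) (at z) \<longleftrightarrow> (g has_derivative D) (at z)" if "z \<in> S" for z D
    using has_derivative_transform_within_open[of f D z UNIV S g]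
      has_derivative_transform_within_open[of g D z UNIV S f] Suc.prems assms(1) that by auto
  then have "frechet_derivative f (at z) = frechet_derivative g (at z)" if "z \<in> S" for z
    using that by (simp add: frechet_derivative_def)
  then have "Ck_on k S (\<lambda>z. frechet_derivative f (at z) i) = Ck_on k S (\<lambda>z. frechet_derivative g (at z) i)"
    for i by (intro Suc.IH) simp
  then show ?case
    using * by (simp add: differentiable_def)
qed

text \<open>Partial derivatives can exist where the Frechet derivative does not, so
  differentiability stays a separate conjunct. Once it holds, the derivatives along the two basis
  vectors agree with \<open>dx f\<close> and \<open>dy f\<close> on the open set, which is all that
  \<open>Ck_on\<close> sees.\<close>

lemma Ck_on_Suc_iff:
  assumes "open S"
  shows "Ck_on (Suc k) S f \<longleftrightarrow>
    (\<forall>z\<in>S. f differentiable (at z)) \<and> Ck_on k S (dx f) \<and> Ck_on k S (dy f)"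
proof (cases "\<forall>z\<in>S. f differentiable (at z)")
  case True
  have "Ck_on k S (\<lambda>z. frechet_derivative f (at z) (1, 0)) \<longleftrightarrow> Ck_on k S (dx f)"
    by (rule Ck_on_cong[OF assms]) (simp add: frechet_derivative_pair True)
  moreover have "Ck_on k S (\<lambda>z. frechet_derivative f (at z) (0, 1)) \<longleftrightarrow> Ck_on k S (dy f)"
    by (rule Ck_on_cong[OF assms]) (simp add: frechet_derivative_pair True)
  moreover have B: "(Basis :: (real \<times> real) set) = {(1, 0), (0, 1)}"
    by (auto simp: Basis_prod_def)
  ultimately show ?thesis
    unfolding Ck_on.simps(2) B using True by simp
next
  case False
  then show ?thesis
    unfolding Ck_on.simps(2) by blast
qed

declare Ck_on.simps(2) [simp del]

text \<open>The induction step of all regularity arguments: any explicit formula for the gradient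
  that is valid on \<open>S\<close> may stand in for \<open>dx f\<close> and
  \<open>dy f\<close>.\<close>

lemma Ck_on_SucI:
  assumes "open S" "\<And>z. z \<in> S \<Longrightarrow> has_gradient f (A z) (B z) z" "Ck_on k S A" "Ck_on k S B"
  shows "Ck_on (Suc k) S f"
proof -
  have "Ck_on k S (dx f)" "Ck_on k S (dy f)"
    using assms(3,4) Ck_on_cong[OF assms(1), of "dx f" A] Ck_on_cong[OF assms(1), of "dy f" B]
      has_gradient_dx(2)[OF assms(2)] has_gradient_dy(2)[OF assms(2)] by simp_all
  then show ?thesis
    by (simp add: Ck_on_Suc_iff[OF assms(1)] has_gradient_differentiable[OF assms(2)])
qed

lemma Ck_on_gradient:
  assumes "Ck_on (Suc k) S f" "z \<in> S"
  shows "has_gradient f (dx f z) (dy f z) z"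
  using assms by (auto simp: Ck_on.simps(2) intro: differentiable_gradient)

lemma Ck_on_dx_dy:
  assumes "open S" "Ck_on (Suc k) S f"
  shows "Ck_on k S (dx f)" "Ck_on k S (dy f)"
  using assms(2) by (simp_all add: Ck_on_Suc_iff[OF assms(1)])

lemma Ck_on_continuous_on: "Ck_on k S f \<Longrightarrow> continuous_on S f"
proof (cases k)
  case (Suc k')
  then show "Ck_on k S f \<Longrightarrow> continuous_on S f"
    using differentiable_imp_continuous_within[where s=UNIV]
    by (auto simp: Ck_on.simps(2) intro!: continuous_at_imp_continuous_on)
qed auto

lemma Ck_on_SucD:
  fixes f :: "real \<times> real \<Rightarrow> real"
  assumes "open S"
  shows "Ck_on (Suc k) S f \<Longrightarrow> Ck_on k S f"
proof (induction k arbitrary: f)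
  case 0
  then have "continuous_on S f" by (rule Ck_on_continuous_on)
  then show ?case by simp
next
  case (Suc k)
  have "\<forall>z\<in>S. f differentiable (at z)"
    using Suc.prems by (simp add: Ck_on.simps(2))
  moreover have "Ck_on k S (dx f)" "Ck_on k S (dy f)"
    by (rule Suc.IH[OF Ck_on_dx_dy(1)[OF assms Suc.prems]], rule Suc.IH[OF Ck_on_dx_dy(2)[OF assms Suc.prems]])
  ultimately show ?case
    by (simp only: Ck_on_Suc_iff[OF assms])
qed

lemma Ck_on_subset: "Ck_on k S f \<Longrightarrow> T \<subseteq> S \<Longrightarrow> Ck_on k T f"
  by (induction k arbitrary: f) (auto simp: Ck_on.simps(2) intro: continuous_on_subset)

lemma Ck_on_const: "Ck_on k S (\<lambda>_. a)"
  by (induction k arbitrary: a) (auto simp: Ck_on.simps(2))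

lemma Ck_on_add:
  assumes "open S"
  shows "Ck_on k S f \<Longrightarrow> Ck_on k S g \<Longrightarrow> Ck_on k S (\<lambda>z::real \<times> real. f z + g z)"
proof (induction k arbitrary: f g)
  case 0
  then show ?case by (auto intro: continuous_on_add)
next
  case (Suc k)
  have *: "Ck_on k S (\<lambda>z. dx f z + dx g z)" "Ck_on k S (\<lambda>z. dy f z + dy g z)"
    using Ck_on_dx_dy[OF assms] Suc.prems by (simp_all add: Suc.IH)
  have "has_gradient (\<lambda>z. f z + g z) (dx f z + dx g z) (dy f z + dy g z) z"
    if "z \<in> S" for z
    using that Suc.prems by (intro has_gradient_add Ck_on_gradient)
  from Ck_on_SucI[OF assms this *] show ?case .
qed

lemma Ck_on_mult:
  assumes "open S"
  shows "Ck_on k S f \<Longrightarrow> Ck_on k S g \<Longrightarrow> Ck_on k S (\<lambda>z::real \<times> real. f z * g z)"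
proof (induction k arbitrary: f g)
  case 0
  then show ?case by (auto intro: continuous_on_mult)
next
  case (Suc k)
  note D = Ck_on_SucD[OF assms Suc.prems(1)] Ck_on_SucD[OF assms Suc.prems(2)]
  have *: "Ck_on k S (\<lambda>z. dx f z * g z + f z * dx g z)" "Ck_on k S (\<lambda>z. dy f z * g z + f z * dy g z)"
    using Ck_on_dx_dy[OF assms] Suc.prems D by (simp_all add: Ck_on_add[OF assms] Suc.IH)
  have "has_gradient (\<lambda>z. f z * g z) (dx f z * g z + f z * dx g z) (dy f z * g z + f z * dy g z) z"
    if "z \<in> S" for z
    using that Suc.prems by (intro has_gradient_mult Ck_on_gradient)
  from Ck_on_SucI[OF assms this *] show ?case .
qed

lemma Ck_on_compose:
  fixes F f g :: "real \<times> real \<Rightarrow> real"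
  assumes "open S" "open T" "\<And>z. z \<in> T \<Longrightarrow> (f z, g z) \<in> S"
  shows "Ck_on k S F \<Longrightarrow> Ck_on k T f \<Longrightarrow> Ck_on k T g \<Longrightarrow> Ck_on k T (\<lambda>z. F (f z, g z))"
proof (induction k arbitrary: F)
  case 0
  then show ?case
    using assms(3) by (auto intro!: continuous_on_compose2[of S F T "\<lambda>z. (f z, g z)"] continuous_on_Pair)
next
  case (Suc k)
  note D = Ck_on_SucD[OF assms(2) Suc.prems(2)] Ck_on_SucD[OF assms(2) Suc.prems(3)]
  have "Ck_on k T (\<lambda>z. dx F (f z, g z))" "Ck_on k T (\<lambda>z. dy F (f z, g z))"
    by (rule Suc.IH[OF Ck_on_dx_dy(1)[OF assms(1) Suc.prems(1)] D],
        rule Suc.IH[OF Ck_on_dx_dy(2)[OF assms(1) Suc.prems(1)] D])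
  moreover have "Ck_on k T (dx f)" "Ck_on k T (dy f)" "Ck_on k T (dx g)" "Ck_on k T (dy g)"
    by (simp_all add: Ck_on_dx_dy[OF assms(2)] Suc.prems)
  ultimately have *:
    "Ck_on k T (\<lambda>z. dx F (f z, g z) * dx f z + dy F (f z, g z) * dx g z)"
    "Ck_on k T (\<lambda>z. dx F (f z, g z) * dy f z + dy F (f z, g z) * dy g z)"
    by (simp_all add: Ck_on_add[OF assms(2)] Ck_on_mult[OF assms(2)])
  have "has_gradient (\<lambda>z. F (f z, g z)) (dx F (f z, g z) * dx f z + dy F (f z, g z) * dx g z)
      (dx F (f z, g z) * dy f z + dy F (f z, g z) * dy g z) z" if "z \<in> T" for z
    using has_gradient_compose[of F _ _ f z g, OF Ck_on_gradient[OF Suc.prems(1) assms(3)[OF that]]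
        Ck_on_gradient[OF Suc.prems(2) that] Ck_on_gradient[OF Suc.prems(3) that]] .
  from Ck_on_SucI[OF assms(2) this *] show ?case .
qed

section \<open>Smooth functions, and smoothness gained from differential equations\<close>

lemma smooth_on_gradient:
  fixes f :: "real \<times> real \<Rightarrow> real"
  shows "smooth_on S f \<Longrightarrow> z \<in> S \<Longrightarrow> has_gradient f (dx f z) (dy f z) z"
  using Ck_on_gradient[of 0 S f z] by (simp add: smooth_on_def)

lemma smooth_on_continuous_on: "smooth_on S f \<Longrightarrow> continuous_on S f"
  using Ck_on_continuous_on[of 0 S f] by (simp add: smooth_on_def)

lemma smooth_on_cong:
  "open S \<Longrightarrow> (\<And>z. z \<in> S \<Longrightarrow> f z = g z) \<Longrightarrow> smooth_on S f \<Longrightarrow> smooth_on S g"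
  using Ck_on_cong[of S f g] by (simp add: smooth_on_def)

lemma smooth_on_subset: "smooth_on S f \<Longrightarrow> T \<subseteq> S \<Longrightarrow> smooth_on T f"
  by (auto simp: smooth_on_def intro: Ck_on_subset)

lemma smooth_on_const: "smooth_on S (\<lambda>_. a)"
  by (simp add: smooth_on_def Ck_on_const)

lemma smooth_on_dx_dy:
  fixes f :: "real \<times> real \<Rightarrow> real"
  assumes "open S" "smooth_on S f"
  shows "smooth_on S (dx f)" "smooth_on S (dy f)"
  using assms(2) Ck_on_dx_dy[OF assms(1), of _ f] by (simp_all add: smooth_on_def)

lemma smooth_on_add:
  fixes f g :: "real \<times> real \<Rightarrow> real"
  shows "open S \<Longrightarrow> smooth_on S f \<Longrightarrow> smooth_on S g \<Longrightarrow> smooth_on S (\<lambda>z. f z + g z)"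
  by (simp add: smooth_on_def Ck_on_add)

lemma smooth_on_mult:
  fixes f g :: "real \<times> real \<Rightarrow> real"
  shows "open S \<Longrightarrow> smooth_on S f \<Longrightarrow> smooth_on S g \<Longrightarrow> smooth_on S (\<lambda>z. f z * g z)"
  by (simp add: smooth_on_def Ck_on_mult)

lemma smooth_on_uminus:
  fixes f :: "real \<times> real \<Rightarrow> real"
  assumes "open S" "smooth_on S f"
  shows "smooth_on S (\<lambda>z. - f z)"
  using smooth_on_mult[OF assms(1) smooth_on_const assms(2), of "-1"] by simp

lemma smooth_on_diff:
  fixes f g :: "real \<times> real \<Rightarrow> real"
  assumes "open S" "smooth_on S f" "smooth_on S g"
  shows "smooth_on S (\<lambda>z. f z - g z)"
  using smooth_on_add[OF assms(1,2) smooth_on_uminus[OF assms(1,3)]] by simp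

lemmas smooth_on_intros =
  smooth_on_const smooth_on_add smooth_on_mult smooth_on_uminus smooth_on_diff

lemma smooth_on_gradientI:
  assumes "open S" "\<And>z. z \<in> S \<Longrightarrow> has_gradient f (A z) (B z) z" "smooth_on S A" "smooth_on S B"
  shows "smooth_on S f"
  unfolding smooth_on_def
proof
  fix k
  have "Ck_on (Suc k) S f"
    using assms by (intro Ck_on_SucI[of S f A B]) (simp_all add: smooth_on_def)
  then show "Ck_on k S f"
    by (rule Ck_on_SucD[OF assms(1)])
qed

text \<open>Bootstrap: differentiability gives continuity, and if \<open>s\<close> and
  \<open>t\<close> are of class C^k, the right-hand sides are too, so \<open>s\<close> and
  \<open>t\<close> are of class C^(k+1). This serves the components of parallel forms and the root
  of the metric determinant.\<close>

lemma smooth_on_linear_system: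
  assumes S: "open S"
    and s: "\<And>z. z \<in> S \<Longrightarrow> has_gradient s (A z * s z + B z * t z) (A' z * s z + B' z * t z) z"
    and t: "\<And>z. z \<in> S \<Longrightarrow> has_gradient t (C z * s z + D z * t z) (C' z * s z + D' z * t z) z"
    and "smooth_on S A" "smooth_on S B" "smooth_on S A'" "smooth_on S B'"
    and "smooth_on S C" "smooth_on S D" "smooth_on S C'" "smooth_on S D'"
  shows "smooth_on S s \<and> smooth_on S t"
proof -
  have "Ck_on k S s \<and> Ck_on k S t" for k
  proof (induction k)
    case 0
    then show ?case
      using s t by (auto intro!: continuous_at_imp_continuous_on has_gradient_isCont)
  next
      case (Suc k)
    have *: "Ck_on k S (\<lambda>z. P z * s z + Q z * t z)" if "smooth_on S P" "smooth_on S Q" for P Q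
      using that Suc by (simp add: smooth_on_def Ck_on_add[OF S] Ck_on_mult[OF S])
    have "Ck_on (Suc k) S s"
      by (rule Ck_on_SucI[OF S s * *]) (use assms in auto)
    moreover have "Ck_on (Suc k) S t"
      by (rule Ck_on_SucI[OF S t * *]) (use assms in auto)
    ultimately show ?case ..
  qed
  then show ?thesis
    by (simp add: smooth_on_def)
qed

text \<open>The same bootstrap for a nonlinear equation: the gradient of \<open>1 / f\<close> is the
  square of \<open>1 / f\<close> times smooth functions.\<close>

lemma smooth_on_inverse:
  fixes f :: "real \<times> real \<Rightarrow> real"
  assumes S: "open S" and f: "smooth_on S f" and nz: "\<And>z. z \<in> S \<Longrightarrow> f z \<noteq> 0"
  shows "smooth_on S (\<lambda>z. 1 / f z)"
proof -
  have g: "has_gradient (\<lambda>z. 1 / f z) ((- 1) * ((1 / f z) * (1 / f z)) * dx f z)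
      ((- 1) * ((1 / f z) * (1 / f z)) * dy f z) z" if "z \<in> S" for z
  proof -
    have "((\<lambda>t. 1 / t) has_real_derivative (- 1) * ((1 / f z) * (1 / f z))) (at (f z))"
      using nz[OF that] by (auto intro!: derivative_eq_intros simp: power2_eq_square field_simps)
    from has_gradient_compose_real[OF this smooth_on_gradient[OF f that]] show ?thesis .
  qed
  note d = smooth_on_dx_dy[OF S f]
  have "Ck_on k S (\<lambda>z. 1 / f z)" for k
  proof (induction k)
    case 0
    then show ?case
      using smooth_on_continuous_on[OF f] nz by (auto intro!: continuous_intros)
  next
    case (Suc k)
    have *: "Ck_on k S (\<lambda>z. (- 1) * ((1 / f z) * (1 / f z)) * u z)" if "smooth_on S u" for u
      by (rule Ck_on_mult[OF S Ck_on_mult[OF S Ck_on_const Ck_on_mult[OF S Suc Suc]]])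
        (use that in \<open>simp add: smooth_on_def\<close>)
    from Ck_on_SucI[OF S g *[OF d(1)] *[OF d(2)]] show ?case .
  qed
  then show ?thesis
    by (simp add: smooth_on_def)
qed

section \<open>Potentials and local inverses\<close>

lemma closed_form_has_potential:
  assumes S: "open S" "z0 \<in> S" and sm: "smooth_on S \<alpha>" "smooth_on S \<beta>"
    and closed: "\<And>z. z \<in> S \<Longrightarrow> dy \<alpha> z = dx \<beta> z"
  obtains Q \<phi> where "open Q" "z0 \<in> Q" "Q \<subseteq> S" "\<And>z. z \<in> Q \<Longrightarrow> has_gradient \<phi> (\<alpha> z) (\<beta> z) z"
proof -
  obtain A B where AB: "open A" "open B" "z0 \<in> A \<times> B" "A \<times> B \<subseteq> S"
    using open_prod_elim[OF S] by metis
  obtain e where e: "e > 0" "cball (fst z0) e \<subseteq> A"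
    using open_contains_cball AB by (metis mem_Times_iff)
  obtain e' where e': "e' > 0" "cball (snd z0) e' \<subseteq> B"
    using open_contains_cball AB by (metis mem_Times_iff)
  define a b c d where "a = fst z0 - e" and "b = fst z0 + e" and "c = snd z0 - e'" and "d = snd z0 + e'"
  have sub: "{a..b} \<times> {c..d} \<subseteq> S"
    using e e' AB(4) unfolding cball_eq_atLeastAtMost a_def b_def c_def d_def by blast
  let ?X = "{a<..<b}" and ?Y = "{c<..<d}"
  have z0: "z0 \<in> ?X \<times> ?Y"
    using e e' by (simp add: a_def b_def c_def d_def mem_Times_iff)
  have cont: "continuous_on S \<alpha>" "continuous_on S \<beta>" "continuous_on S (dx \<beta>)"
    using sm smooth_on_continuous_on smooth_on_dx_dy[OF S(1) sm(2)] by auto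
  \<comment> \<open>Integration of the form along the lower edge of the rectangle and then
    vertically upwards. The rectangle is closed and inside \<open>S\<close>, so the integrands are
    continuous up to the starting edges \<open>a\<close> and \<open>c\<close>.\<close>
  define \<phi> where "\<phi> x y = integral {a..x} (\<lambda>s. \<alpha> (s, c)) + integral {c..y} (\<lambda>t. \<beta> (x, t))" for x y
  have cont_y: "continuous_on {c..d} (\<lambda>t. \<beta> (x, t))" if "x \<in> ?X" for x
    using that sub by (intro continuous_on_compose2[OF cont(2)] continuous_intros) auto
  have cont_x: "continuous_on {a..b} (\<lambda>s. \<alpha> (s, c))"
    using sub z0 by (intro continuous_on_compose2[OF cont(1)] continuous_intros) auto
  have phi_y: "((\<lambda>y. \<phi> x y) has_real_derivative \<beta> (x, y)) (at y)" if "x \<in> ?X" "y \<in> ?Y" for x y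
  proof -
    have "((\<lambda>y. integral {c..y} (\<lambda>t. \<beta> (x, t))) has_real_derivative \<beta> (x, y)) (at y)"
      using integral_has_real_derivative[OF cont_y[OF that(1)], of y] that(2)
      by (simp add: at_within_Icc_at)
    then show ?thesis
      unfolding \<phi>_def by (auto intro!: derivative_eq_intros)
  qed
  have phi_x: "((\<lambda>x. \<phi> x y) has_real_derivative \<alpha> (x, y)) (at x)" if "x \<in> ?X" "y \<in> ?Y" for x y
  proof -
    have y: "{c..y} \<subseteq> {c..d}" "c \<le> y"
      using that by auto
    \<comment> \<open>Differentiation under the integral sign. Closedness turns the new integrand
      into the y-derivative of \<open>\<alpha>\<close>, so the integral telescopes to
      \<open>\<alpha> (x, y) - \<alpha> (x, c)\<close>, and the second term cancels against the
      lower edge.\<close>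
    have "((\<lambda>x. integral (cbox c y) (\<lambda>t. \<beta> (x, t))) has_field_derivative
        integral (cbox c y) (\<lambda>t. dx \<beta> (x, t))) (at x within ?X)"
    proof (rule leibniz_rule_field_derivative[where f = "\<lambda>x t. \<beta> (x, t)" and fx = "\<lambda>x t. dx \<beta> (x, t)"])
      fix x t assume "x \<in> ?X" "t \<in> cbox c y"
      then have "(x, t) \<in> S"
        using sub y by auto
      from has_gradient_dx(1)[OF smooth_on_gradient[OF sm(2) this]]
      show "((\<lambda>x. \<beta> (x, t)) has_field_derivative dx \<beta> (x, t)) (at x within ?X)"
        by (simp add: has_field_derivative_at_within)
    next
      fix x assume "x \<in> ?X"
      then show "(\<lambda>t. \<beta> (x, t)) integrable_on cbox c y"
        using continuous_on_subset[OF cont_y y(1)] by (intro integrable_continuous) auto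
    next
      show "continuous_on (?X \<times> cbox c y) (\<lambda>(x, t). dx \<beta> (x, t))"
        unfolding case_prod_eta using sub y by (intro continuous_on_subset[OF cont(3)]) auto
    qed (use that in auto)
    moreover have "((\<lambda>t. dx \<beta> (x, t)) has_integral \<alpha> (x, y) - \<alpha> (x, c)) {c..y}"
    proof (rule fundamental_theorem_of_calculus[OF y(2)])
      fix t assume "t \<in> {c..y}"
      then have "(x, t) \<in> S"
        using sub y that by auto
      from has_gradient_dy(1)[OF smooth_on_gradient[OF sm(1) this]] closed[OF this]
      show "((\<lambda>t. \<alpha> (x, t)) has_vector_derivative dx \<beta> (x, t)) (at t within {c..y})"
        by (simp add: has_real_derivative_iff_has_vector_derivative has_vector_derivative_at_within)
    qed
    moreover have "((\<lambda>x. integral {a..x} (\<lambda>s. \<alpha> (s, c))) has_real_derivative \<alpha> (x, c)) (at x)"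
      using integral_has_real_derivative[OF cont_x, of x] that by (simp add: at_within_Icc_at)
    ultimately show ?thesis
      unfolding \<phi>_def using that
      by (auto intro!: derivative_eq_intros simp: integral_unique at_within_open[of _ ?X])
  qed
  have "has_gradient (\<lambda>z. \<phi> (fst z) (snd z)) (\<alpha> z) (\<beta> z) z" if z: "z \<in> ?X \<times> ?Y" for z
  proof -
    obtain x y where xy: "z = (x, y)" "x \<in> ?X" "y \<in> ?Y"
      using z by auto
    \<comment> \<open>Partial derivatives alone do not give a gradient; continuity of one of them,
      here \<open>\<beta>\<close>, upgrades them to a total derivative.\<close>
    have "((\<lambda>(x, y). \<phi> x y) has_derivative
        (\<lambda>(tx, ty). \<alpha> (x, y) * tx + blinfun_mult_right (\<beta> (x, y)) ty)) (at (x, y) within ?X \<times> ?Y)"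
    proof (rule has_derivative_partialsI)
      show "((\<lambda>x. \<phi> x y) has_derivative (*) (\<alpha> (x, y))) (at x within ?X)"
        using phi_x[OF xy(2,3)] has_derivative_at_withinI unfolding has_field_derivative_def by blast
      show "((\<lambda>y. \<phi> x y) has_derivative blinfun_apply (blinfun_mult_right (\<beta> (x, y)))) (at y within ?Y)"
        if "x \<in> ?X" "y \<in> ?Y" for x y
        using phi_y[OF that] has_derivative_at_withinI
        unfolding has_field_derivative_def blinfun_mult_right.rep_eq by blast
      have "continuous_on (?X \<times> ?Y) (\<lambda>z. blinfun_mult_right (\<beta> z))"
        using sub by (intro bounded_linear.continuous_on[OF bounded_linear_blinfun_mult_right]
            continuous_on_subset[OF cont(2)]) auto
      then show "continuous (at (x, y) within ?X \<times> ?Y) (\<lambda>(x, y). blinfun_mult_right (\<beta> (x, y)))"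
        using xy by (simp add: continuous_on_eq_continuous_within case_prod_beta')
    qed (use xy in auto)
    moreover have "at (x, y) within ?X \<times> ?Y = at (x, y)"
      using xy by (intro at_within_open open_Times) auto
    ultimately show ?thesis
      unfolding has_gradient_def xy(1) by (simp add: case_prod_beta' blinfun_mult_right.rep_eq)
  qed
  moreover have "open (?X \<times> ?Y)" "?X \<times> ?Y \<subseteq> S"
    using sub by (auto intro: open_Times)
  ultimately show thesis
    using that z0 by blast
qed

text \<open>Made for inverse maps, whose derivative is the inverse Jacobian matrix evaluated at the
  inverse map itself. Composition preserves class C^k, so each order of \<open>(X, Y)\<close> yields
  the next.\<close>

lemma smooth_on_autonomous_system:
  fixes X Y :: "real \<times> real \<Rightarrow> real"
  assumes S: "open S" and W: "open W" and im: "\<And>w. w \<in> W \<Longrightarrow> (X w, Y w) \<in> S"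
    and X: "\<And>w. w \<in> W \<Longrightarrow> has_gradient X (A (X w, Y w)) (B (X w, Y w)) w"
    and Y: "\<And>w. w \<in> W \<Longrightarrow> has_gradient Y (C (X w, Y w)) (D (X w, Y w)) w"
    and sm: "smooth_on S A" "smooth_on S B" "smooth_on S C" "smooth_on S D"
  shows "smooth_on W X \<and> smooth_on W Y"
proof -
  have "Ck_on k W X \<and> Ck_on k W Y" for k
  proof (induction k)
    case 0
    then show ?case
      using X Y by (auto intro!: continuous_at_imp_continuous_on has_gradient_isCont)
  next
    case (Suc k)
    have *: "Ck_on k W (\<lambda>w. P (X w, Y w))" if "smooth_on S P" for P
      by (rule Ck_on_compose[OF S W im]) (use that Suc in \<open>auto simp: smooth_on_def\<close>)
    show ?case
      using Ck_on_SucI[OF W X *[OF sm(1)] *[OF sm(2)]] Ck_on_SucI[OF W Y *[OF sm(3)] *[OF sm(4)]] ..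
  qed
  then show ?thesis
    by (simp add: smooth_on_def)
qed

text \<open>The inverse function theorem gives a differentiable inverse only. Cramer's rule writes
  its derivative as cofactors over the Jacobian, all smooth functions at the inverse point, and the
  autonomous system then gives every order.\<close>

lemma local_point_transformation:
  assumes S: "open S" "z0 \<in> S" and sm: "smooth_on S U" "smooth_on S V"
    and jac: "\<And>z. z \<in> S \<Longrightarrow> dx U z * dy V z - dy U z * dx V z \<noteq> 0"
  obtains N where "z0 \<in> N" "N \<subseteq> S" "point_transformation N U V"
proof -
  \<comment> \<open>The four matrix units as bounded linear maps: with them the derivative is a
    combination with continuous coefficients, so its continuity in operator norm is
    immediate.\<close>
  define L1 L2 L3 L4 :: "(real \<times> real) \<Rightarrow>\<^sub>L (real \<times> real)" where
    "L1 = Blinfun (\<lambda>w. (fst w, 0))" and "L2 = Blinfun (\<lambda>w. (snd w, 0))" and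
    "L3 = Blinfun (\<lambda>w. (0, fst w))" and "L4 = Blinfun (\<lambda>w. (0, snd w))"
  have [simp]: "blinfun_apply L1 w = (fst w, 0)" "blinfun_apply L2 w = (snd w, 0)"
    "blinfun_apply L3 w = (0, fst w)" "blinfun_apply L4 w = (0, snd w)" for w
    unfolding L1_def L2_def L3_def L4_def
    by (simp_all add: bounded_linear_Blinfun_apply bounded_linear_Pair bounded_linear_fst
        bounded_linear_snd bounded_linear_zero)
  let ?F = "\<lambda>z. (U z, V z)"
  define F' where "F' z = dx U z *\<^sub>R L1 + dy U z *\<^sub>R L2 + dx V z *\<^sub>R L3 + dy V z *\<^sub>R L4" for z
  define \<Delta> where "\<Delta> z = dx U z * dy V z - dy U z * dx V z" for z
  define G' where "G' z = (1 / \<Delta> z) *\<^sub>R (dy V z *\<^sub>R L1 - dy U z *\<^sub>R L2 - dx V z *\<^sub>R L3 + dx U z *\<^sub>R L4)" for z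
  have F'_apply: "blinfun_apply (F' z) w = (dx U z * fst w + dy U z * snd w, dx V z * fst w + dy V z * snd w)" for z w
    by (simp add: F'_def blinfun.add_left blinfun.scaleR_left)
  have G'_apply: "blinfun_apply (G' z) w =
      ((dy V z * fst w - dy U z * snd w) / \<Delta> z, (dx U z * snd w - dx V z * fst w) / \<Delta> z)" for z w
    by (simp add: G'_def blinfun.add_left blinfun.diff_left blinfun.scaleR_left)
  have GF: "blinfun_apply (G' z) (blinfun_apply (F' z) w) = w" if "z \<in> S" for z w
  proof -
    have nz: "\<Delta> z \<noteq> 0" using jac[OF that] by (simp add: \<Delta>_def)
    have "dy V z * (dx U z * fst w + dy U z * snd w) - dy U z * (dx V z * fst w + dy V z * snd w) = \<Delta> z * fst w"
      "dx U z * (dx V z * fst w + dy V z * snd w) - dx V z * (dx U z * fst w + dy U z * snd w) = \<Delta> z * snd w"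
      by (simp_all add: \<Delta>_def algebra_simps)
    then show ?thesis
      using nz by (simp add: F'_apply G'_apply prod_eq_iff)
  qed
  have FG: "blinfun_apply (F' z) (blinfun_apply (G' z) w) = w" if "z \<in> S" for z w
  proof -
    have nz: "\<Delta> z \<noteq> 0" using jac[OF that] by (simp add: \<Delta>_def)
    have "dx U z * (dy V z * fst w - dy U z * snd w) + dy U z * (dx U z * snd w - dx V z * fst w) = \<Delta> z * fst w"
      "dx V z * (dy V z * fst w - dy U z * snd w) + dy V z * (dx U z * snd w - dx V z * fst w) = \<Delta> z * snd w"
      by (simp_all add: \<Delta>_def algebra_simps)
    then show ?thesis
      using nz by (simp add: F'_apply G'_apply prod_eq_iff add_divide_distrib[symmetric])
  qed
  note d = smooth_on_dx_dy[OF S(1) sm(1)] smooth_on_dx_dy[OF S(1) sm(2)]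
  have derF: "(?F has_derivative blinfun_apply (F' z)) (at z)" if "z \<in> S" for z
    using has_derivative_Pair[OF smooth_on_gradient[OF sm(1) that, unfolded has_gradient_def]
        smooth_on_gradient[OF sm(2) that, unfolded has_gradient_def]]
    by (simp add: F'_apply[abs_def])
  have contF: "continuous_on S F'"
    unfolding F'_def[abs_def] using d[THEN smooth_on_continuous_on] by (intro continuous_intros)
  have inv0: "G' z0 o\<^sub>L F' z0 = id_blinfun"
    by (rule blinfun_eqI) (simp add: GF[OF S(2)])
  obtain N W g g' where N: "open N" "N \<subseteq> S" "z0 \<in> N" "open W" "homeomorphism N W ?F g"
    and g: "\<And>y. y \<in> W \<Longrightarrow> (g has_derivative (g' y)) (at y)"
      "\<And>y. y \<in> W \<Longrightarrow> g' y = inv (blinfun_apply (F' (g y)))"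
    by (rule inverse_function_theorem[OF S(1) derF contF S(2) inv0]) (assumption | rule that)+
  have gS: "g w \<in> S" if "w \<in> W" for w
    using N that by (auto simp: homeomorphism_def)
  have g': "(g has_derivative blinfun_apply (G' (g w))) (at w)" if "w \<in> W" for w
  proof -
    have "g' w = blinfun_apply (G' (g w))"
      unfolding g(2)[OF that] by (rule inv_equality) (simp_all add: FG GF gS that)
    then show ?thesis using g(1)[OF that] by simp
  qed
  have sm\<Delta>: "smooth_on S (\<lambda>z. 1 / \<Delta> z)"
    unfolding \<Delta>_def using jac d by (intro smooth_on_inverse smooth_on_intros S(1)) auto
  have cof: "smooth_on S (\<lambda>z. dy V z * (1 / \<Delta> z))" "smooth_on S (\<lambda>z. - dy U z * (1 / \<Delta> z))"
    "smooth_on S (\<lambda>z. - dx V z * (1 / \<Delta> z))" "smooth_on S (\<lambda>z. dx U z * (1 / \<Delta> z))"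
    by (intro smooth_on_intros S(1) d sm\<Delta>)+
  have "smooth_on W (\<lambda>w. fst (g w)) \<and> smooth_on W (\<lambda>w. snd (g w))"
  proof (rule smooth_on_autonomous_system[OF S(1) N(4)])
    show "has_gradient (\<lambda>w. fst (g w)) (dy V (fst (g w), snd (g w)) * (1 / \<Delta> (fst (g w), snd (g w))))
        (- dy U (fst (g w), snd (g w)) * (1 / \<Delta> (fst (g w), snd (g w)))) w" if "w \<in> W" for w
      using has_derivative_fst[OF g'[OF that]]
      by (simp add: has_gradient_def G'_apply diff_divide_distrib mult.commute)
    show "has_gradient (\<lambda>w. snd (g w)) (- dx V (fst (g w), snd (g w)) * (1 / \<Delta> (fst (g w), snd (g w))))
        (dx U (fst (g w), snd (g w)) * (1 / \<Delta> (fst (g w), snd (g w)))) w" if "w \<in> W" for w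
      using has_derivative_snd[OF g'[OF that]]
      by (simp add: has_gradient_def G'_apply diff_divide_distrib mult.commute)
    show "(fst (g w), snd (g w)) \<in> S" if "w \<in> W" for w
      using gS[OF that] by simp
  qed (fact cof)+
  moreover have FN: "?F ` N = W" "\<And>z. z \<in> N \<Longrightarrow> g (U z, V z) = z"
    using N(5) by (auto simp: homeomorphism_def)
  ultimately have "\<exists>X Y. smooth_on (?F ` N) X \<and> smooth_on (?F ` N) Y \<and>
      (\<forall>z\<in>N. (X (U z, V z), Y (U z, V z)) = z)"
    by - (rule exI[of _ "\<lambda>w. fst (g w)"], rule exI[of _ "\<lambda>w. snd (g w)"], simp)
  then have "point_transformation N U V"
    unfolding point_transformation_def FN(1)
    using N(1,4) smooth_on_subset[OF sm(1) N(2)] smooth_on_subset[OF sm(2) N(2)] by blast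
  then show thesis
    using that N by blast
qed

section \<open>Affine coordinates along curves\<close>

lemma times_differentiable_on_2:
  "times_differentiable_on 2 I y \<longleftrightarrow> (\<forall>x\<in>I. y differentiable (at x) \<and> deriv y differentiable (at x))"
  by (auto simp: times_differentiable_on_def numeral_2_eq_2 less_Suc_eq)

lemma times_differentiable_on_3:
  "times_differentiable_on 3 I y \<longleftrightarrow> (\<forall>x\<in>I. y differentiable (at x) \<and> deriv y differentiable (at x)
    \<and> deriv (deriv y) differentiable (at x))"
  by (auto simp: times_differentiable_on_def numeral_3_eq_3 less_Suc_eq)

lemma differentiable_DERIV_deriv:
  fixes f :: "real \<Rightarrow> real"
  shows "f differentiable (at x) \<Longrightarrow> (f has_real_derivative deriv f x) (at x)"
  by (simp add: DERIV_deriv_iff_real_differentiable)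

lemma inj_on_nonzero_derivative:
  assumes I: "open_interval I"
    and u: "\<And>x. x \<in> I \<Longrightarrow> (u has_real_derivative u1 x) (at x)" "\<And>x. x \<in> I \<Longrightarrow> u1 x \<noteq> 0"
  shows "inj_on u I"
proof (rule linorder_inj_onI)
  fix x y assume xy: "x < y" "x \<in> I" "y \<in> I"
  have sub: "{x..y} \<subseteq> I"
    using mem_is_interval_1_I[OF _ xy(2,3)] I by (simp add: open_interval_def subset_iff)
  have "\<exists>z. x < z \<and> z < y \<and> u y - u x = (y - x) * u1 z"
    by (rule MVT2[OF xy(1)]) (use u(1) sub in auto)
  then obtain z where "x < z" "z < y" "u y - u x = (y - x) * u1 z"
    by blast
  moreover then have "z \<in> I"
    using sub by auto
  ultimately show "u x \<noteq> u y"
    using u(2) xy(1) by auto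
qed auto

text \<open>Differentiability of \<open>w\<close> is derived, not assumed: on the open image,
  \<open>w\<close> is \<open>v\<close> composed with the inverse of \<open>u\<close>.
  Differentiating by \<open>u\<close> means differentiating by \<open>x\<close> and dividing by
  \<open>u1\<close>; doing this twice gives the quotient.\<close>

lemma reparametrized_graph:
  assumes I: "open_interval I"
    and u: "\<And>x. x \<in> I \<Longrightarrow> (u has_real_derivative u1 x) (at x)"
    and u1: "\<And>x. x \<in> I \<Longrightarrow> (u1 has_real_derivative u2 x) (at x)"
    and nz: "\<And>x. x \<in> I \<Longrightarrow> u1 x \<noteq> 0"
    and v: "\<And>x. x \<in> I \<Longrightarrow> (v has_real_derivative v1 x) (at x)"
    and v1: "\<And>x. x \<in> I \<Longrightarrow> (v1 has_real_derivative v2 x) (at x)"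
    and w: "\<And>x. x \<in> I \<Longrightarrow> w (u x) = v x"
  shows "open_interval (u ` I)" "times_differentiable_on 2 (u ` I) w"
    "\<And>x. x \<in> I \<Longrightarrow> deriv (deriv w) (u x) = (v2 x * u1 x - v1 x * u2 x) / u1 x ^ 3"
proof -
  have inj: "inj_on u I"
    by (rule inj_on_nonzero_derivative[OF I u nz])
  have cont: "continuous_on I u"
    using DERIV_isCont[OF u] by (simp add: continuous_at_imp_continuous_on)
  have openI: "open I"
    using I by (simp add: open_interval_def)
  have openJ: "open (u ` I)"
    by (rule invariance_of_domain[OF cont openI inj])
  have "connected (u ` I)"
    using I by (intro connected_continuous_image[OF cont]) (simp add: open_interval_def is_interval_connected_1)
  then show J: "open_interval (u ` I)"
    using openJ I by (simp add: open_interval_def is_interval_connected_1)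
  define \<iota> where "\<iota> = inv_into I u"
  have \<iota>: "\<iota> (u x) = x" if "x \<in> I" for x
    using inj that by (simp add: \<iota>_def)
  have "continuous_on (u ` I) \<iota>"
    by (rule continuous_on_inverse_open[OF openI cont]) (use \<iota> in auto)
  then have cont\<iota>: "isCont \<iota> (u x)" if "x \<in> I" for x
    using openJ that by (simp add: continuous_on_eq_continuous_at)
  have d\<iota>: "(\<iota> has_real_derivative inverse (u1 x)) (at (u x))" if "x \<in> I" for x
  proof (rule has_field_derivative_inverse_basic[where f = u and t = "u ` I"])
    show "(u has_real_derivative u1 x) (at (\<iota> (u x)))"
      using u[OF that] \<iota>[OF that] by simp
  qed (use that nz openJ \<iota> cont\<iota> in auto)
  \<comment> \<open>Chain rule in the new variable, for any \<open>h\<close> that agrees with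
    \<open>k\<close> along the image. It is applied to \<open>w\<close> with \<open>v\<close>, then
    to \<open>deriv w\<close> with the quotient of \<open>v1\<close> by \<open>u1\<close>.\<close>
  have comp: "(h has_real_derivative k' x / u1 x) (at (u x))"
    if x: "x \<in> I" and h: "\<And>x. x \<in> I \<Longrightarrow> h (u x) = k x" and k: "(k has_real_derivative k' x) (at x)"
    for h k k' x
  proof -
    have "((\<lambda>\<xi>. k (\<iota> \<xi>)) has_real_derivative k' x * inverse (u1 x)) (at (u x))"
      using DERIV_chain2[of k "k' x" \<iota> "u x" "inverse (u1 x)" UNIV] k d\<iota>[OF x] \<iota>[OF x] by simp
    then have "((\<lambda>\<xi>. k (\<iota> \<xi>)) has_real_derivative k' x / u1 x) (at (u x))"
      by (simp add: divide_inverse)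
    then show ?thesis
      by (rule has_field_derivative_transform_within_open[OF _ openJ]) (use x h \<iota> in auto)
  qed
  have w1: "(w has_real_derivative v1 x / u1 x) (at (u x))" if "x \<in> I" for x
    using comp[where h = w and k = v and k' = v1, OF that w v[OF that]] .
  have q: "((\<lambda>x. v1 x / u1 x) has_real_derivative (v2 x * u1 x - v1 x * u2 x) / (u1 x * u1 x)) (at x)"
    if "x \<in> I" for x
    using DERIV_divide[OF v1[OF that] u1[OF that] nz[OF that]] .
  have w2: "(deriv w has_real_derivative (v2 x * u1 x - v1 x * u2 x) / (u1 x * u1 x) / u1 x) (at (u x))"
    if "x \<in> I" for x
    using comp[where h = "deriv w" and k = "\<lambda>x. v1 x / u1 x"
        and k' = "\<lambda>x. (v2 x * u1 x - v1 x * u2 x) / (u1 x * u1 x)", OF that DERIV_imp_deriv[OF w1] q[OF that]] .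
  show "times_differentiable_on 2 (u ` I) w"
    using w1 w2 by (auto simp: times_differentiable_on_2 real_differentiable_def)
  show "deriv (deriv w) (u x) = (v2 x * u1 x - v1 x * u2 x) / u1 x ^ 3" if "x \<in> I" for x
    using DERIV_imp_deriv[OF w2[OF that]] by (simp add: power3_eq_cube mult.assoc)
qed

text \<open>The 1-form s dx + t dy is covariantly constant for the symbols -a, ..., -f. Symmetry of
  the connection shows in the expression shared by the y-derivative of \<open>s\<close> and the
  x-derivative of \<open>t\<close>, which makes the form closed.\<close>

definition parallel_form ::
    "(real \<times> real) set \<Rightarrow> (real \<times> real \<Rightarrow> real) \<Rightarrow> (real \<times> real \<Rightarrow> real) \<Rightarrow> (real \<times> real \<Rightarrow> real) \<Rightarrow>
     (real \<times> real \<Rightarrow> real) \<Rightarrow> (real \<times> real \<Rightarrow> real) \<Rightarrow> (real \<times> real \<Rightarrow> real) \<Rightarrow>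
     (real \<times> real \<Rightarrow> real) \<Rightarrow> (real \<times> real \<Rightarrow> real) \<Rightarrow> bool" where
  "parallel_form S a b c d e f s t \<longleftrightarrow> (\<forall>z\<in>S.
     has_gradient s (- a z * s z - d z * t z) (- b z * s z - e z * t z) z \<and>
     has_gradient t (- b z * s z - e z * t z) (- c z * s z - f z * t z) z)"

text \<open>Since the form is constant, only the velocity (1, y') of the graph gets differentiated:
  the result is the form paired with the covariant acceleration, whose two components multiply
  \<open>s\<close> and \<open>t\<close>.\<close>

lemma parallel_form_along_graph:
  assumes par: "parallel_form N a b c d e f s t"
    and x: "(x, y x) \<in> N" "(y has_real_derivative deriv y x) (at x)"
      "(deriv y has_real_derivative y2) (at x)"
  shows "((\<lambda>x. s (x, y x) + t (x, y x) * deriv y x) has_real_derivative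
    s (x, y x) * (- a (x, y x) - 2 * b (x, y x) * deriv y x - c (x, y x) * (deriv y x)\<^sup>2)
    + t (x, y x) * (y2 - d (x, y x) - 2 * e (x, y x) * deriv y x - f (x, y x) * (deriv y x)\<^sup>2)) (at x)"
proof -
  have "has_gradient s (- a (x, y x) * s (x, y x) - d (x, y x) * t (x, y x))
      (- b (x, y x) * s (x, y x) - e (x, y x) * t (x, y x)) (x, y x)"
    "has_gradient t (- b (x, y x) * s (x, y x) - e (x, y x) * t (x, y x))
      (- c (x, y x) * s (x, y x) - f (x, y x) * t (x, y x)) (x, y x)"
    using par x(1) by (auto simp: parallel_form_def)
  note * = this[THEN has_gradient_compose_curve[where x = "\<lambda>x. x", OF _ DERIV_ident x(2)]]
  show ?thesis
    by (rule DERIV_cong[OF DERIV_add[OF *(1) DERIV_mult[OF *(2) x(3)]]])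
      (simp add: power2_eq_square algebra_simps)
qed

lemma affine_coordinates_transform:
  assumes U: "\<And>z. z \<in> N \<Longrightarrow> has_gradient U (s1 z) (t1 z) z"
    and V: "\<And>z. z \<in> N \<Longrightarrow> has_gradient V (s2 z) (t2 z) z"
    and par: "parallel_form N a b c d e f s1 t1" "parallel_form N a b c d e f s2 t2"
    and nz: "\<And>z. z \<in> N \<Longrightarrow> s1 z * t2 z - t1 z * s2 z \<noteq> 0"
    and hg: "\<And>z. z \<in> N \<Longrightarrow> h z = a z - 2 * e z" "\<And>z. z \<in> N \<Longrightarrow> g z = f z - 2 * b z"
  shows "transforms_to N U V (cubic_eq c g h d) (linear_eq (\<lambda>_. 0) (\<lambda>_. 0) (\<lambda>_. 0))"
  unfolding transforms_to_def
proof (intro allI impI)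
  fix I y w
  assume I: "open_interval I" and y: "times_differentiable_on 2 I y" and graph: "graph_in N I y"
    and U': "\<forall>x\<in>I. deriv (\<lambda>t. U (t, y t)) x \<noteq> 0" and w: "\<forall>x\<in>I. w (U (x, y x)) = V (x, y x)"
  define y2 where "y2 = deriv (deriv y)"
  have yN: "(x, y x) \<in> N" if "x \<in> I" for x
    using graph that by (simp add: graph_in_def)
  have dy: "(y has_real_derivative deriv y x) (at x)" "(deriv y has_real_derivative y2 x) (at x)"
    if "x \<in> I" for x
    using y that by (auto simp: times_differentiable_on_2 y2_def intro: differentiable_DERIV_deriv)
  define P where "P x = - a (x, y x) - 2 * b (x, y x) * deriv y x - c (x, y x) * (deriv y x)\<^sup>2" for x
  define Q where "Q x = y2 x - d (x, y x) - 2 * e (x, y x) * deriv y x - f (x, y x) * (deriv y x)\<^sup>2" for x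
  define u1 where "u1 x = s1 (x, y x) + t1 (x, y x) * deriv y x" for x
  define v1 where "v1 x = s2 (x, y x) + t2 (x, y x) * deriv y x" for x
  define u2 where "u2 x = s1 (x, y x) * P x + t1 (x, y x) * Q x" for x
  define v2 where "v2 x = s2 (x, y x) * P x + t2 (x, y x) * Q x" for x
  have u: "((\<lambda>t. U (t, y t)) has_real_derivative u1 x) (at x)"
    and v: "((\<lambda>t. V (t, y t)) has_real_derivative v1 x) (at x)" if "x \<in> I" for x
    using has_gradient_compose_curve[where x = "\<lambda>x. x", OF U[OF yN[OF that]] DERIV_ident dy(1)[OF that]]
      has_gradient_compose_curve[where x = "\<lambda>x. x", OF V[OF yN[OF that]] DERIV_ident dy(1)[OF that]]
    by (simp_all add: u1_def v1_def)
  have u': "(u1 has_real_derivative u2 x) (at x)" and v': "(v1 has_real_derivative v2 x) (at x)"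
    if "x \<in> I" for x
    using parallel_form_along_graph[OF par(1) yN[OF that] dy[OF that]]
      parallel_form_along_graph[OF par(2) yN[OF that] dy[OF that]]
    by (simp_all add: u1_def[abs_def] v1_def[abs_def] u2_def v2_def P_def Q_def)
  have nz1: "u1 x \<noteq> 0" if "x \<in> I" for x
    using U' u[OF that] that DERIV_imp_deriv by force
  have rep: "open_interval ((\<lambda>x. U (x, y x)) ` I)" "times_differentiable_on 2 ((\<lambda>x. U (x, y x)) ` I) w"
    "\<And>x. x \<in> I \<Longrightarrow> deriv (deriv w) (U (x, y x)) = (v2 x * u1 x - v1 x * u2 x) / u1 x ^ 3"
  proof -
    note * = reparametrized_graph[where u = "\<lambda>t. U (t, y t)" and v = "\<lambda>t. V (t, y t)"
        and ?u1.0 = u1 and ?u2.0 = u2 and ?v1.0 = v1 and ?v2.0 = v2 and w = w, OF I]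
    show "open_interval ((\<lambda>x. U (x, y x)) ` I)"
      by (rule *(1)) (use u u' nz1 v v' w in simp_all)
    show "times_differentiable_on 2 ((\<lambda>x. U (x, y x)) ` I) w"
      by (rule *(2)) (use u u' nz1 v v' w in simp_all)
    show "deriv (deriv w) (U (x, y x)) = (v2 x * u1 x - v1 x * u2 x) / u1 x ^ 3" if "x \<in> I" for x
      by (rule *(3)) (use u u' nz1 v v' w that in simp_all)
  qed
  \<comment> \<open>Velocity (1, y') and acceleration (\<open>P\<close>, \<open>Q\<close>) are both
    expressed in the coframe, so their determinant \<open>Q - y' P\<close> is multiplied by the
    coframe determinant. Expanding it with h = a - 2e and g = f - 2b gives the cubic
    equation.\<close>
  have key: "v2 x * u1 x - v1 x * u2 x =
      (s1 (x, y x) * t2 (x, y x) - t1 (x, y x) * s2 (x, y x)) * cubic_eq c g h d x (y x) (deriv y x) (y2 x)"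
    if "x \<in> I" for x
  proof -
    have "cubic_eq c g h d x (y x) (deriv y x) (y2 x) = Q x - deriv y x * P x"
      by (simp add: hg[OF yN[OF that]] cubic_eq_def P_def Q_def power2_eq_square power3_eq_cube
          algebra_simps)
    then show ?thesis
      unfolding u1_def v1_def u2_def v2_def by (simp only:) (simp add: algebra_simps)
  qed
  have "deriv (deriv w) (U (x, y x)) = 0 \<longleftrightarrow> cubic_eq c g h d x (y x) (deriv y x) (y2 x) = 0"
    if "x \<in> I" for x
    using rep(3)[OF that] key[OF that] nz1[OF that] nz[OF yN[OF that]] by simp
  then show "solution2 (cubic_eq c g h d) I y \<longleftrightarrow>
      solution2 (linear_eq (\<lambda>_. 0) (\<lambda>_. 0) (\<lambda>_. 0)) ((\<lambda>x. U (x, y x)) ` I) w"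
    using I y rep(1,2) by (simp add: solution2_def linear_eq_def y2_def)
qed

section \<open>Parallel coframes of flat metrics\<close>

lemma has_gradient_eq:
  "has_gradient f A B z \<Longrightarrow> A = A' \<Longrightarrow> B = B' \<Longrightarrow> has_gradient f A' B' z"
  by simp

text \<open>Here \<open>C\<close> and \<open>S\<close> are the values of \<open>cos, sin\<close> (\<open>\<epsilon> = 1\<close>) or \<open>cosh, sinh\<close> (\<open>\<epsilon> = -1\<close>)
  at the rotation angle, whose derivative is \<open>K * \<rho> / N\<close>.\<close>

lemma rotated_form_derivative:
  fixes N N' \<rho> \<epsilon> D K \<eta> C S \<theta> T T' tr X Y :: real
  assumes N: "N \<noteq> 0" and \<rho>: "\<rho> * \<rho> = \<epsilon> * D" and \<epsilon>: "\<epsilon> * \<epsilon> = 1"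
    and C: "N' * \<theta> + 2 * tr * N * \<theta> + 2 * K * T = 2 * N * X"
    and S: "N' * T - 2 * N * T' - 2 * D * K * \<theta> = 2 * N * Y"
  shows "- (\<eta> * N' / (2 * N)) * (\<rho> * C * \<theta> - S * T)
      + \<eta> * (- (tr * \<rho>) * C * \<theta> + \<rho> * (- \<epsilon> * S * (K * \<rho> / N)) * \<theta> - (C * (K * \<rho> / N) * T + S * T'))
      = - \<eta> * (\<rho> * C * X - S * Y)" (is "?L1 = ?R1")
    and "- (\<eta> * N' / (2 * N)) * (C * T + \<epsilon> * (\<rho> * S * \<theta>))
      + \<eta> * ((- \<epsilon> * S * (K * \<rho> / N)) * T + C * T' + \<epsilon> * (- (tr * \<rho>) * S * \<theta> + \<rho> * (C * (K * \<rho> / N)) * \<theta>))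
      = - \<eta> * (C * Y + \<epsilon> * (\<rho> * S * X))" (is "?L2 = ?R2")
proof -
  define k where "k = K * \<rho> / N"
  define \<eta>' where "\<eta>' = - (\<eta> * N' / (2 * N))"
  have k: "k * N = K * \<rho>" and \<eta>': "2 * \<eta>' * N = - \<eta> * N'"
    using N by (simp_all add: k_def \<eta>'_def field_simps)
  have nz: "2 * N \<noteq> 0"
    using N by simp
  \<comment> \<open>Multiplication by 2N removes all denominators, so that the claim follows
    polynomially from the relations for \<open>k\<close>, \<open>\<eta>'\<close>,
    \<open>\<rho>\<close> and \<open>\<epsilon>\<close> and the two structure equations.\<close>
  have "2 * N * (\<eta>' * (\<rho> * C * \<theta> - S * T)
      + \<eta> * (- (tr * \<rho>) * C * \<theta> + \<rho> * (- \<epsilon> * S * k) * \<theta> - (C * k * T + S * T')))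
      = 2 * N * (- \<eta> * (\<rho> * C * X - S * Y))"
    using k \<eta>' \<rho> \<epsilon> C S by algebra
  from mult_left_cancel[OF nz, THEN iffD1, OF this] show "?L1 = ?R1"
    unfolding k_def \<eta>'_def .
  have "2 * N * (\<eta>' * (C * T + \<epsilon> * (\<rho> * S * \<theta>))
      + \<eta> * ((- \<epsilon> * S * k) * T + C * T' + \<epsilon> * (- (tr * \<rho>) * S * \<theta> + \<rho> * (C * k) * \<theta>)))
      = 2 * N * (- \<eta> * (C * Y + \<epsilon> * (\<rho> * S * X)))"
    using k \<eta>' \<rho> \<epsilon> C S by algebra
  from mult_left_cancel[OF nz, THEN iffD1, OF this] show "?L2 = ?R2"
    unfolding k_def \<eta>'_def .
qed

text \<open>One pair of functions for rotations and boosts, so that definite and indefinite metrics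
  need no separate treatment later. The last identity says that the transformation has determinant
  1.\<close>

lemma circular_or_hyperbolic_functions:
  assumes "\<epsilon> = 1 \<or> \<epsilon> = (-1::real)"
  obtains C S :: "real \<Rightarrow> real" where
    "\<And>x. (C has_real_derivative - \<epsilon> * S x) (at x)" "\<And>x. (S has_real_derivative C x) (at x)"
    "\<And>x. C x * C x + \<epsilon> * (S x * S x) = 1"
proof (cases "\<epsilon> = 1")
  case True
  show thesis
    by (rule that[of cos sin])
      (auto intro!: derivative_eq_intros simp: True power2_eq_square[symmetric])
next
  case False
  then have "\<epsilon> = -1"
    using assms by simp
  then show thesis
    by (intro that[of cosh sinh])
      (auto intro!: derivative_eq_intros simp: power2_eq_square[symmetric] cosh_square_eq)
qed

text \<open>\<open>flat\<close> lists the curvature components; they are the compatibility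
  conditions of the system in \<open>parallel_form\<close>, each solved for one derivative.\<close>

lemma parallel_coframe:
  assumes R: "open R" "z0 \<in> R"
    and sm: "smooth_on R a" "smooth_on R b" "smooth_on R c" "smooth_on R d" "smooth_on R e" "smooth_on R f"
    and flat:
      "\<And>z. z \<in> R \<Longrightarrow> dy a z = dx b z + c z * d z - b z * e z"
      "\<And>z. z \<in> R \<Longrightarrow> dy b z = dx c z + b z * b z - b z * f z - a z * c z + c z * e z"
      "\<And>z. z \<in> R \<Longrightarrow> dy d z = dx e z - b z * d z + d z * f z - e z * e z + a z * e z"
      "\<And>z. z \<in> R \<Longrightarrow> dx f z = dy e z + c z * d z - b z * e z"
    and metric: "compatible_metric R a b c d e f p q r"
  obtains Q s1 t1 s2 t2 where "open Q" "z0 \<in> Q" "Q \<subseteq> R"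
    "parallel_form Q a b c d e f s1 t1" "parallel_form Q a b c d e f s2 t2"
    "\<And>z. z \<in> Q \<Longrightarrow> s1 z * t2 z - t1 z * s2 z \<noteq> 0"
proof -
  define D where "D z = p z * r z - q z * q z" for z
  have D0: "D z \<noteq> 0" if "z \<in> R" for z
    using metric that by (simp add: D_def compatible_metric_def power2_eq_square)
  have smm: "smooth_on R p" "smooth_on R q" "smooth_on R r"
    using metric by (simp_all add: compatible_metric_def)
  have g: "has_gradient p (- 2 * (a z * p z + d z * q z)) (- 2 * (b z * p z + e z * q z)) z"
    "has_gradient q (- b z * p z - (a z + e z) * q z - d z * r z)
      (- c z * p z - (b z + f z) * q z - e z * r z) z"
    "has_gradient r (- 2 * (b z * q z + e z * r z)) (- 2 * (c z * q z + f z * r z)) z"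
    if "z \<in> R" for z
    using metric smooth_on_gradient[OF smm(1) that] smooth_on_gradient[OF smm(2) that]
      smooth_on_gradient[OF smm(3) that] that
    unfolding compatible_metric_def by metis+
  obtain \<mu> \<nu> where N0: "r z0 * (\<mu> * \<mu>) - 2 * q z0 * (\<mu> * \<nu>) + p z0 * (\<nu> * \<nu>) \<noteq> 0"
  proof -
    have "p z0 \<noteq> 0 \<or> r z0 \<noteq> 0 \<or> q z0 \<noteq> 0"
      using D0[OF R(2)] by (auto simp: D_def)
    then show thesis
      \<comment> \<open>These vectors give the values \<open>p\<close>, \<open>r\<close> and
        \<open>r - 2 q + p\<close> at the point; if \<open>p\<close> and \<open>r\<close> vanish
        there, the last one is \<open>-2 q\<close>, which is nonzero.\<close>
      using that[of 0 1] that[of 1 0] that[of 1 1] by fastforce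
  qed
  text \<open>\<open>N / D\<close> is the squared norm of \<open>\<theta> = \<mu> dx + \<nu> dy\<close>, and \<open>(T1, T2) / \<rho>\<close> below is its Hodge dual.\<close>
  define N where "N z = \<mu> * \<mu> * r z + - 2 * \<mu> * \<nu> * q z + \<nu> * \<nu> * p z" for z
  define T1 where "T1 z = \<mu> * q z + - \<nu> * p z" for z
  define T2 where "T2 z = \<mu> * r z + - \<nu> * q z" for z
  define \<epsilon> where "\<epsilon> = sgn (D z0)"
  define \<sigma> where "\<sigma> = sgn (N z0)"
  have \<epsilon>: "\<epsilon> = 1 \<or> \<epsilon> = -1" "\<epsilon> * D z0 > 0"
    using D0[OF R(2)] by (auto simp: \<epsilon>_def sgn_if)
  have "N z0 \<noteq> 0"
    using N0 by (simp add: N_def algebra_simps)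
  then have \<sigma>: "\<sigma> = 1 \<or> \<sigma> = -1" "\<sigma> * N z0 > 0"
    by (auto simp: \<sigma>_def sgn_if)
  have \<epsilon>\<epsilon>: "\<epsilon> * \<epsilon> = 1"
    using \<epsilon> by auto
  define W where "W = (R \<inter> (\<lambda>z. \<epsilon> * D z) -` {0<..}) \<inter> (\<lambda>z. \<sigma> * N z) -` {0<..}"
  have cont: "continuous_on R (\<lambda>z. \<epsilon> * D z)" "continuous_on R (\<lambda>z. \<sigma> * N z)"
    unfolding D_def N_def by (intro continuous_intros smm[THEN smooth_on_continuous_on])+
  have W: "open W" "z0 \<in> W" "W \<subseteq> R"
  proof -
    have "open (R \<inter> (\<lambda>z. \<epsilon> * D z) -` {0<..})"
      by (rule continuous_open_preimage[OF cont(1) R(1) open_greaterThan])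
    then show "open W"
      unfolding W_def
      by (rule continuous_open_preimage[OF continuous_on_subset[OF cont(2)] _ open_greaterThan, rotated]) auto
  qed (use R(2) \<epsilon>(2) \<sigma>(2) in \<open>auto simp: W_def\<close>)
  have Wpos: "\<epsilon> * D z > 0" "\<sigma> * N z > 0" "N z \<noteq> 0" "z \<in> R" if "z \<in> W" for z
    using that by (auto simp: W_def)
  \<comment> \<open>The derivatives of \<open>p\<close>, \<open>q\<close>, \<open>r\<close> are
    already replaced by the right-hand sides of the metric equations, so later identities between
    these expressions are purely polynomial.\<close>
  define Nx where "Nx z = \<mu> * \<mu> * (- 2 * (b z * q z + e z * r z))
    + - 2 * \<mu> * \<nu> * (- b z * p z - (a z + e z) * q z - d z * r z)
    + \<nu> * \<nu> * (- 2 * (a z * p z + d z * q z))" for z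
  define Ny where "Ny z = \<mu> * \<mu> * (- 2 * (c z * q z + f z * r z))
    + - 2 * \<mu> * \<nu> * (- c z * p z - (b z + f z) * q z - e z * r z)
    + \<nu> * \<nu> * (- 2 * (b z * p z + e z * q z))" for z
  define T1x where "T1x z = \<mu> * (- b z * p z - (a z + e z) * q z - d z * r z)
    + - \<nu> * (- 2 * (a z * p z + d z * q z))" for z
  define T1y where "T1y z = \<mu> * (- c z * p z - (b z + f z) * q z - e z * r z)
    + - \<nu> * (- 2 * (b z * p z + e z * q z))" for z
  define T2x where "T2x z = \<mu> * (- 2 * (b z * q z + e z * r z))
    + - \<nu> * (- b z * p z - (a z + e z) * q z - d z * r z)" for z
  define T2y where "T2y z = \<mu> * (- 2 * (c z * q z + f z * r z))
    + - \<nu> * (- c z * p z - (b z + f z) * q z - e z * r z)" for z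
  have gN: "has_gradient N (Nx z) (Ny z) z" and gT1: "has_gradient T1 (T1x z) (T1y z) z"
    and gT2: "has_gradient T2 (T2x z) (T2y z) z" if "z \<in> R" for z
    unfolding N_def[abs_def] T1_def[abs_def] T2_def[abs_def] Nx_def Ny_def T1x_def T1y_def T2x_def T2y_def
    by (intro has_gradient_add has_gradient_cmult g that)+
  have gD: "has_gradient D (- 2 * (a z + e z) * D z) (- 2 * (b z + f z) * D z) z" if "z \<in> R" for z
    unfolding D_def[abs_def]
    by (rule has_gradient_eq[OF has_gradient_diff[OF has_gradient_mult has_gradient_mult]], (rule g[OF that])+)
      (simp_all add: algebra_simps)

  \<comment> \<open>The form with constant components has squared norm N / D, so the factor
    \<open>\<eta> * \<rho>\<close> makes it a unit form. For (T1, T2), of squared norm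
    \<open>N\<close>, the factor is \<open>\<eta>\<close>.\<close>
  define \<rho> where "\<rho> z = sqrt (\<epsilon> * D z)" for z
  define \<eta> where "\<eta> z = 1 / sqrt (\<sigma> * N z)" for z
  have \<rho>2: "\<rho> z * \<rho> z = \<epsilon> * D z" and \<rho>0: "\<rho> z > 0" and \<eta>0: "\<eta> z > 0" if "z \<in> W" for z
    using Wpos[OF that] by (simp_all add: \<rho>_def \<eta>_def)
  have g\<rho>: "has_gradient \<rho> (- ((a z + e z) * \<rho> z)) (- ((b z + f z) * \<rho> z)) z" if "z \<in> W" for z
  proof -
    have "has_gradient \<rho> (inverse (\<rho> z) / 2 * (\<epsilon> * (- 2 * (a z + e z) * D z)))
        (inverse (\<rho> z) / 2 * (\<epsilon> * (- 2 * (b z + f z) * D z))) z"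
      unfolding \<rho>_def
      by (rule has_gradient_compose_real[OF DERIV_real_sqrt has_gradient_cmult[OF gD]]) (use Wpos that in auto)
    moreover have "inverse (\<rho> z) / 2 * (\<epsilon> * (- 2 * k * D z)) = - (k * \<rho> z)" for k
    proof -
      have "inverse (\<rho> z) * \<rho> z = 1"
        using \<rho>0[OF that] by simp
      then show ?thesis
        using \<rho>2[OF that] by algebra
    qed
    ultimately show ?thesis by (simp only:)
  qed
  have g\<eta>: "has_gradient \<eta> (- (\<eta> z * Nx z / (2 * N z))) (- (\<eta> z * Ny z / (2 * N z))) z" if "z \<in> W" for z
  proof -
    have "((\<lambda>x. 1 / sqrt x) has_real_derivative - (1 / sqrt (\<sigma> * N z)) / (2 * (\<sigma> * N z))) (at (\<sigma> * N z))"
      using Wpos(2)[OF that] by (auto intro!: derivative_eq_intros simp: field_simps)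
    from has_gradient_compose_real[OF this has_gradient_cmult[OF gN[OF Wpos(4)[OF that]]]]
    show ?thesis
      unfolding \<eta>_def[abs_def] by (rule has_gradient_eq) (use \<sigma> in auto)
  qed

  define iN where "iN z = 1 / N z" for z
  have smW: "smooth_on W a" "smooth_on W b" "smooth_on W c" "smooth_on W d" "smooth_on W e" "smooth_on W f"
    using sm smooth_on_subset W(3) by auto
  have smN: "smooth_on W N"
    unfolding N_def[abs_def] using smm[THEN smooth_on_subset, OF W(3)] by (intro smooth_on_intros W(1))
  have smiN: "smooth_on W iN"
    unfolding iN_def[abs_def] using smooth_on_inverse[OF W(1) smN Wpos(3)] .
  have giN: "has_gradient iN (- (iN z * iN z * Nx z)) (- (iN z * iN z * Ny z)) z" if "z \<in> W" for z
  proof -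
    have "((\<lambda>x. 1 / x) has_real_derivative - (iN z * iN z)) (at (N z))"
      using Wpos(3)[OF that] by (auto intro!: derivative_eq_intros simp: iN_def field_simps)
    from has_gradient_compose_real[OF this gN[OF Wpos(4)[OF that]]]
    show ?thesis
      by (simp add: iN_def[abs_def])
  qed
  have sm\<rho>: "smooth_on W \<rho>"
  proof -
    have "smooth_on W (\<lambda>z. - (a z + e z))" "smooth_on W (\<lambda>z. - (b z + f z))"
      by (intro smooth_on_intros W(1) smW)+
    moreover have "has_gradient \<rho> (- (a z + e z) * \<rho> z + 0 * \<rho> z) (- (b z + f z) * \<rho> z + 0 * \<rho> z) z"
      if "z \<in> W" for z
      by (rule has_gradient_eq[OF g\<rho>[OF that]]) (simp_all add: algebra_simps)
    \<comment> \<open>The scalar equation for \<open>\<rho>\<close> is read as a decoupled linear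
      system with both unknowns equal to \<open>\<rho>\<close>; this avoids iterated derivatives of
      the square root.\<close>
    ultimately have "smooth_on W \<rho> \<and> smooth_on W \<rho>"
      by (intro smooth_on_linear_system[OF W(1), where A = "\<lambda>z. - (a z + e z)" and A' = "\<lambda>z. - (b z + f z)"
            and B = "\<lambda>_. 0" and B' = "\<lambda>_. 0" and C = "\<lambda>z. - (a z + e z)" and C' = "\<lambda>z. - (b z + f z)"
            and D = "\<lambda>_. 0" and D' = "\<lambda>_. 0"] smooth_on_const)
    then show ?thesis ..
  qed
  \<comment> \<open>Components of the wedge product of the constant form with its covariant
    derivative. The wedge product of that form with (T1, T2) is \<open>N\<close>, so the covariant
    derivative contains the dual form (T1, T2) / \<open>\<rho>\<close> with coefficient K *
    \<open>\<rho>\<close> / N, the 1-form called kappa.\<close>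
  define Kx where "Kx z = \<mu> * (\<mu> * b z + \<nu> * e z) - \<nu> * (\<mu> * a z + \<nu> * d z)" for z
  define Ky where "Ky z = \<mu> * (\<mu> * c z + \<nu> * f z) - \<nu> * (\<mu> * b z + \<nu> * e z)" for z
  have gKx: "has_gradient Kx (\<mu> * (\<mu> * dx b z + \<nu> * dx e z) - \<nu> * (\<mu> * dx a z + \<nu> * dx d z))
      (\<mu> * (\<mu> * dy b z + \<nu> * dy e z) - \<nu> * (\<mu> * dy a z + \<nu> * dy d z)) z"
    and gKy: "has_gradient Ky (\<mu> * (\<mu> * dx c z + \<nu> * dx f z) - \<nu> * (\<mu> * dx b z + \<nu> * dx e z))
      (\<mu> * (\<mu> * dy c z + \<nu> * dy f z) - \<nu> * (\<mu> * dy b z + \<nu> * dy e z)) z" if "z \<in> R" for z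
    unfolding Kx_def[abs_def] Ky_def[abs_def]
    by (intro has_gradient_diff has_gradient_add has_gradient_cmult sm[THEN smooth_on_gradient] that)+
  have smK: "smooth_on W Kx" "smooth_on W Ky"
    unfolding Kx_def[abs_def] Ky_def[abs_def] by (intro smooth_on_intros W(1) smW)+
  define \<kappa>x where "\<kappa>x z = Kx z * \<rho> z * iN z" for z
  define \<kappa>y where "\<kappa>y z = Ky z * \<rho> z * iN z" for z
  have sm\<kappa>: "smooth_on W \<kappa>x" "smooth_on W \<kappa>y"
    unfolding \<kappa>x_def[abs_def] \<kappa>y_def[abs_def] by (intro smooth_on_intros W(1) smK sm\<rho> smiN)+
  have closed: "dy \<kappa>x z = dx \<kappa>y z" if z: "z \<in> W" for z
  proof -
    note zR = Wpos(4)[OF z]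
    define Kxy where "Kxy = \<mu> * (\<mu> * dy b z + \<nu> * dy e z) - \<nu> * (\<mu> * dy a z + \<nu> * dy d z)"
    define Kyx where "Kyx = \<mu> * (\<mu> * dx c z + \<nu> * dx f z) - \<nu> * (\<mu> * dx b z + \<nu> * dx e z)"
    have "dy \<kappa>x z = (Kxy * \<rho> z + Kx z * (- ((b z + f z) * \<rho> z))) * iN z
        + Kx z * \<rho> z * (- (iN z * iN z * Ny z))"
      using has_gradient_dy(2)[OF has_gradient_mult[OF has_gradient_mult[OF gKx[OF zR] g\<rho>[OF z]] giN[OF z]]]
      by (simp add: \<kappa>x_def[abs_def] Kxy_def)
    moreover have "dx \<kappa>y z = (Kyx * \<rho> z + Ky z * (- ((a z + e z) * \<rho> z))) * iN z
        + Ky z * \<rho> z * (- (iN z * iN z * Nx z))"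
      using has_gradient_dx(2)[OF has_gradient_mult[OF has_gradient_mult[OF gKy[OF zR] g\<rho>[OF z]] giN[OF z]]]
      by (simp add: \<kappa>y_def[abs_def] Kyx_def)
    \<comment> \<open>Closedness of kappa with \<open>\<rho>\<close> and the denominators cleared.
      The equations \<open>flat\<close> are oriented so that, after rewriting, the derivatives of
      the Christoffel symbols cancel between the two sides.\<close>
    moreover have "(Kxy - Kx z * (b z + f z)) * N z - Kx z * Ny z = (Kyx - Ky z * (a z + e z)) * N z - Ky z * Nx z"
      unfolding Kxy_def Kyx_def Kx_def Ky_def N_def Nx_def Ny_def flat[OF zR]
      by (simp add: algebra_simps)
    moreover have "N z * iN z = 1"
      using Wpos(3)[OF z] by (simp add: iN_def)
    ultimately show ?thesis by algebra
  qed
  obtain Q \<phi> where Q: "open Q" "z0 \<in> Q" "Q \<subseteq> W"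
    and g\<phi>: "\<And>z. z \<in> Q \<Longrightarrow> has_gradient \<phi> (\<kappa>x z) (\<kappa>y z) z"
    by (rule closed_form_has_potential[OF W(1,2) sm\<kappa> closed]) (assumption | rule that)+

  obtain C S :: "real \<Rightarrow> real" where CS: "\<And>x. (C has_real_derivative - \<epsilon> * S x) (at x)"
    "\<And>x. (S has_real_derivative C x) (at x)" "\<And>x. C x * C x + \<epsilon> * (S x * S x) = 1"
    by (rule circular_or_hyperbolic_functions[OF \<epsilon>(1)]) (assumption | rule that)+
  text \<open>The components of the two parallel forms: the normalized coframe, rotated back by \<open>\<phi>\<close>.\<close>
  define \<omega> where "\<omega> \<theta> T z = \<eta> z * (\<rho> z * C (\<phi> z) * \<theta> - S (\<phi> z) * T z)"
    for \<theta> and T :: "real \<times> real \<Rightarrow> real" and z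
  define \<omega>' where "\<omega>' \<theta> T z = \<eta> z * (C (\<phi> z) * T z + \<epsilon> * (\<rho> z * S (\<phi> z) * \<theta>))"
    for \<theta> and T :: "real \<times> real \<Rightarrow> real" and z
  have \<kappa>: "\<kappa>x z = Kx z * \<rho> z / N z" "\<kappa>y z = Ky z * \<rho> z / N z" for z
    by (simp_all add: \<kappa>x_def \<kappa>y_def iN_def)
  \<comment> \<open>Stated for a single component: \<open>\<theta>\<close> and \<open>T\<close> will
    be \<open>\<mu>\<close> and \<open>T1\<close>, then \<open>\<nu>\<close> and \<open>T2\<close>.
    The \<open>X\<close> and \<open>Y\<close> quantities will be the Christoffel contractions of the
    two unrotated forms, so the conclusion is the parallel equation.\<close>
  have rot: "has_gradient (\<omega> \<theta> T) (- \<eta> z * (\<rho> z * C (\<phi> z) * Xx - S (\<phi> z) * Yx))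
      (- \<eta> z * (\<rho> z * C (\<phi> z) * Xy - S (\<phi> z) * Yy)) z \<and>
    has_gradient (\<omega>' \<theta> T) (- \<eta> z * (C (\<phi> z) * Yx + \<epsilon> * (\<rho> z * S (\<phi> z) * Xx)))
      (- \<eta> z * (C (\<phi> z) * Yy + \<epsilon> * (\<rho> z * S (\<phi> z) * Xy))) z"
    if z: "z \<in> Q" and T: "has_gradient T Tx Ty z"
      and x: "Nx z * \<theta> + 2 * (a z + e z) * N z * \<theta> + 2 * Kx z * T z = 2 * N z * Xx"
        "Nx z * T z - 2 * N z * Tx - 2 * D z * Kx z * \<theta> = 2 * N z * Yx"
      and y: "Ny z * \<theta> + 2 * (b z + f z) * N z * \<theta> + 2 * Ky z * T z = 2 * N z * Xy"
        "Ny z * T z - 2 * N z * Ty - 2 * D z * Ky z * \<theta> = 2 * N z * Yy"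
    for z \<theta> T Tx Ty Xx Yx Xy Yy
  proof -
    have zW: "z \<in> W" using z Q(3) by auto
    note C' = has_gradient_compose_real[OF CS(1) g\<phi>[OF z]]
    note S' = has_gradient_compose_real[OF CS(2) g\<phi>[OF z]]
    note rx = rotated_form_derivative[OF Wpos(3)[OF zW] \<rho>2[OF zW] \<epsilon>\<epsilon> x]
    note ry = rotated_form_derivative[OF Wpos(3)[OF zW] \<rho>2[OF zW] \<epsilon>\<epsilon> y]
    note c\<theta> = has_gradient_const[of \<theta> z]
    have "has_gradient (\<omega> \<theta> T) (- \<eta> z * (\<rho> z * C (\<phi> z) * Xx - S (\<phi> z) * Yx))
      (- \<eta> z * (\<rho> z * C (\<phi> z) * Xy - S (\<phi> z) * Yy)) z"
      unfolding \<omega>_def[abs_def] rx(1)[symmetric] ry(1)[symmetric]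
      by (rule has_gradient_eq[OF has_gradient_mult[OF g\<eta>[OF zW] has_gradient_diff[OF
              has_gradient_mult[OF has_gradient_mult[OF g\<rho>[OF zW] C'] c\<theta>] has_gradient_mult[OF S' T]]]])
        (simp_all add: \<kappa> algebra_simps)
    moreover have "has_gradient (\<omega>' \<theta> T) (- \<eta> z * (C (\<phi> z) * Yx + \<epsilon> * (\<rho> z * S (\<phi> z) * Xx)))
      (- \<eta> z * (C (\<phi> z) * Yy + \<epsilon> * (\<rho> z * S (\<phi> z) * Xy))) z"
      unfolding \<omega>'_def[abs_def] rx(2)[symmetric] ry(2)[symmetric]
      by (rule has_gradient_eq[OF has_gradient_mult[OF g\<eta>[OF zW] has_gradient_add[OF
              has_gradient_mult[OF C' T] has_gradient_cmult[OF
              has_gradient_mult[OF has_gradient_mult[OF g\<rho>[OF zW] S'] c\<theta>]]]]])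
        (simp_all add: \<kappa> algebra_simps)
    ultimately show ?thesis ..
  qed
  \<comment> \<open>The structure equations of the coframe, multiplied by 2N. They reflect
    compatibility with the metric alone; flatness entered only through the existence of
    \<open>\<phi>\<close>.\<close>
  have id1: "Nx z * \<mu> + 2 * (a z + e z) * N z * \<mu> + 2 * Kx z * T1 z = 2 * N z * (a z * \<mu> + d z * \<nu>)"
    "Nx z * T1 z - 2 * N z * T1x z - 2 * D z * Kx z * \<mu> = 2 * N z * (a z * T1 z + d z * T2 z)"
    "Ny z * \<mu> + 2 * (b z + f z) * N z * \<mu> + 2 * Ky z * T1 z = 2 * N z * (b z * \<mu> + e z * \<nu>)"
    "Ny z * T1 z - 2 * N z * T1y z - 2 * D z * Ky z * \<mu> = 2 * N z * (b z * T1 z + e z * T2 z)" for z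
    unfolding Nx_def Ny_def N_def Kx_def Ky_def T1_def T2_def T1x_def T1y_def D_def
    by (simp_all add: algebra_simps)
  have id2: "Nx z * \<nu> + 2 * (a z + e z) * N z * \<nu> + 2 * Kx z * T2 z = 2 * N z * (b z * \<mu> + e z * \<nu>)"
    "Nx z * T2 z - 2 * N z * T2x z - 2 * D z * Kx z * \<nu> = 2 * N z * (b z * T1 z + e z * T2 z)"
    "Ny z * \<nu> + 2 * (b z + f z) * N z * \<nu> + 2 * Ky z * T2 z = 2 * N z * (c z * \<mu> + f z * \<nu>)"
    "Ny z * T2 z - 2 * N z * T2y z - 2 * D z * Ky z * \<nu> = 2 * N z * (c z * T1 z + f z * T2 z)" for z
    unfolding Nx_def Ny_def N_def Kx_def Ky_def T1_def T2_def T2x_def T2y_def D_def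
    by (simp_all add: algebra_simps)
  have par: "parallel_form Q a b c d e f (\<omega> \<mu> T1) (\<omega> \<nu> T2)" "parallel_form Q a b c d e f (\<omega>' \<mu> T1) (\<omega>' \<nu> T2)"
  proof -
    have "has_gradient (\<omega> \<mu> T1) (- a z * \<omega> \<mu> T1 z - d z * \<omega> \<nu> T2 z) (- b z * \<omega> \<mu> T1 z - e z * \<omega> \<nu> T2 z) z \<and>
      has_gradient (\<omega> \<nu> T2) (- b z * \<omega> \<mu> T1 z - e z * \<omega> \<nu> T2 z) (- c z * \<omega> \<mu> T1 z - f z * \<omega> \<nu> T2 z) z \<and>
      has_gradient (\<omega>' \<mu> T1) (- a z * \<omega>' \<mu> T1 z - d z * \<omega>' \<nu> T2 z) (- b z * \<omega>' \<mu> T1 z - e z * \<omega>' \<nu> T2 z) z \<and>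
      has_gradient (\<omega>' \<nu> T2) (- b z * \<omega>' \<mu> T1 z - e z * \<omega>' \<nu> T2 z) (- c z * \<omega>' \<mu> T1 z - f z * \<omega>' \<nu> T2 z) z"
      if z: "z \<in> Q" for z
    proof -
      have zR: "z \<in> R" using z Q(3) W(3) by auto
      note r1 = rot[OF z gT1[OF zR] id1] and r2 = rot[OF z gT2[OF zR] id2]
      show ?thesis
        by (intro conjI; rule has_gradient_eq[OF r1[THEN conjunct1]] has_gradient_eq[OF r2[THEN conjunct1]]
            has_gradient_eq[OF r1[THEN conjunct2]] has_gradient_eq[OF r2[THEN conjunct2]])
          (simp_all add: \<omega>_def \<omega>'_def algebra_simps)
    qed
    then show "parallel_form Q a b c d e f (\<omega> \<mu> T1) (\<omega> \<nu> T2)" "parallel_form Q a b c d e f (\<omega>' \<mu> T1) (\<omega>' \<nu> T2)"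
      by (simp_all add: parallel_form_def)
  qed
  have "\<omega> \<mu> T1 z * \<omega>' \<nu> T2 z - \<omega> \<nu> T2 z * \<omega>' \<mu> T1 z \<noteq> 0" if "z \<in> Q" for z
  proof -
    have zW: "z \<in> W" using that Q(3) by auto
    have N: "N z = \<mu> * T2 z - \<nu> * T1 z"
      by (simp add: N_def T1_def T2_def algebra_simps)
    \<comment> \<open>Rotating or boosting has determinant 1, so the wedge product \<open>N\<close>
      of the unrotated forms survives up to the positive scale factors.\<close>
    have "\<omega> \<mu> T1 z * \<omega>' \<nu> T2 z - \<omega> \<nu> T2 z * \<omega>' \<mu> T1 z =
        \<eta> z * \<eta> z * \<rho> z * N z * (C (\<phi> z) * C (\<phi> z) + \<epsilon> * (S (\<phi> z) * S (\<phi> z)))"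
      unfolding N \<omega>_def \<omega>'_def by (simp add: algebra_simps)
    then show ?thesis
      using \<eta>0[OF zW] \<rho>0[OF zW] Wpos(3)[OF zW] by (simp add: CS(3))
  qed
  from that[OF Q(1,2) _ par this] show thesis
    using Q(3) W(3) by blast
qed

section \<open>Linearization\<close>

lemma parallel_form_subset: "parallel_form S a b c d e f s t \<Longrightarrow> T \<subseteq> S \<Longrightarrow> parallel_form T a b c d e f s t"
  by (auto simp: parallel_form_def)

text \<open>The parallel equations first make \<open>s\<close> and \<open>t\<close> smooth by the
  linear bootstrap, as integration of the closed form requires; the potential is then smooth because
  its gradient is.\<close>

lemma parallel_form_has_potential:
  assumes S: "open S" "z0 \<in> S"
    and sm: "smooth_on S a" "smooth_on S b" "smooth_on S c" "smooth_on S d" "smooth_on S e" "smooth_on S f"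
    and par: "parallel_form S a b c d e f s t"
  obtains Q U where "open Q" "z0 \<in> Q" "Q \<subseteq> S" "smooth_on Q U"
    "\<And>z. z \<in> Q \<Longrightarrow> has_gradient U (s z) (t z) z"
proof -
  have g: "has_gradient s (- a z * s z - d z * t z) (- b z * s z - e z * t z) z"
    "has_gradient t (- b z * s z - e z * t z) (- c z * s z - f z * t z) z" if "z \<in> S" for z
    using par that by (simp_all add: parallel_form_def)
  have "has_gradient s (- a z * s z + - d z * t z) (- b z * s z + - e z * t z) z"
    "has_gradient t (- b z * s z + - e z * t z) (- c z * s z + - f z * t z) z" if "z \<in> S" for z
    using g[OF that] by simp_all
  moreover have "smooth_on S (\<lambda>z. - a z)" "smooth_on S (\<lambda>z. - b z)" "smooth_on S (\<lambda>z. - c z)"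
    "smooth_on S (\<lambda>z. - d z)" "smooth_on S (\<lambda>z. - e z)" "smooth_on S (\<lambda>z. - f z)"
    by (intro smooth_on_uminus S(1) sm)+
  ultimately have "smooth_on S s \<and> smooth_on S t"
    by (intro smooth_on_linear_system[OF S(1), where A = "\<lambda>z. - a z" and B = "\<lambda>z. - d z"
          and A' = "\<lambda>z. - b z" and B' = "\<lambda>z. - e z" and C = "\<lambda>z. - b z" and D = "\<lambda>z. - e z"
          and C' = "\<lambda>z. - c z" and D' = "\<lambda>z. - f z"])
  then have st: "smooth_on S s" "smooth_on S t"
    by simp_all
  have closed: "dy s z = dx t z" if "z \<in> S" for z
    using has_gradient_dy(2)[OF g(1)[OF that]] has_gradient_dx(2)[OF g(2)[OF that]] by simp
  obtain Q U where Q: "open Q" "z0 \<in> Q" "Q \<subseteq> S" and U: "\<And>z. z \<in> Q \<Longrightarrow> has_gradient U (s z) (t z) z"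
    by (rule closed_form_has_potential[OF S st closed]) (assumption | rule that)+
  have "smooth_on Q U"
    by (rule smooth_on_gradientI[OF Q(1) U smooth_on_subset[OF st(1) Q(3)] smooth_on_subset[OF st(2) Q(3)]])
  from that[OF Q this U] show thesis .
qed

text \<open>\<open>U\<close> and \<open>V\<close> are potentials of the two coframe members, so the
  coframe determinant is their Jacobian: its nonvanishing gives both local invertibility and the
  equivalence of the two equations.\<close>

lemma flat_metric_linearizable:
  assumes R: "open R"
    and sm: "smooth_on R a" "smooth_on R b" "smooth_on R c" "smooth_on R d" "smooth_on R e" "smooth_on R f"
    and hg: "\<And>z. z \<in> R \<Longrightarrow> h z = a z - 2 * e z" "\<And>z. z \<in> R \<Longrightarrow> g z = f z - 2 * b z"
    and criteria: "linearizability_criteria R b c d e g h"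
    and metric: "compatible_metric R a b c d e f p q r"
  shows "linearizable2 R (cubic_eq c g h d)"
  unfolding linearizable2_def
proof
  fix z0 assume z0: "z0 \<in> R"
  have h: "dx h z = dx a z - 2 * dx e z" "dy h z = dy a z - 2 * dy e z" if z: "z \<in> R" for z
  proof -
    have "has_gradient h (dx a z - 2 * dx e z) (dy a z - 2 * dy e z) z"
      by (rule has_gradient_cong[OF R z _ has_gradient_diff[OF smooth_on_gradient[OF sm(1) z]
              has_gradient_cmult[OF smooth_on_gradient[OF sm(5) z]]]]) (simp add: hg)
    then show "dx h z = dx a z - 2 * dx e z" "dy h z = dy a z - 2 * dy e z"
      by (rule has_gradient_dx(2), rule has_gradient_dy(2))
  qed
  have g: "dx g z = dx f z - 2 * dx b z" "dy g z = dy f z - 2 * dy b z" if z: "z \<in> R" for z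
  proof -
    have "has_gradient g (dx f z - 2 * dx b z) (dy f z - 2 * dy b z) z"
      by (rule has_gradient_cong[OF R z _ has_gradient_diff[OF smooth_on_gradient[OF sm(6) z]
              has_gradient_cmult[OF smooth_on_gradient[OF sm(2) z]]]]) (simp add: hg)
    then show "dx g z = dx f z - 2 * dx b z" "dy g z = dy f z - 2 * dy b z"
      by (rule has_gradient_dx(2), rule has_gradient_dy(2))
  qed
  have flat: "dy a z = dx b z + c z * d z - b z * e z"
    "dy b z = dx c z + b z * b z - b z * f z - a z * c z + c z * e z"
    "dy d z = dx e z - b z * d z + d z * f z - e z * e z + a z * e z"
    "dx f z = dy e z + c z * d z - b z * e z" if z: "z \<in> R" for z
  proof -
    have "3 * dx b z + 2 * dx g z + dy h z + 3 * b z * e z - 3 * c z * d z = 0"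
      "dy b z - dx c z + (b z)\<^sup>2 + b z * g z + c z * h z + c z * e z = 0"
      "dy d z - dx e z - b z * d z - d z * g z - (e z)\<^sup>2 - e z * h z = 0"
      "3 * dy e z + 2 * dy h z + dx g z + 3 * b z * e z - 3 * c z * d z = 0"
      using criteria z unfolding linearizability_criteria_def by auto
    note cr = this[unfolded h[OF z] g[OF z] hg(1)[OF z] hg(2)[OF z]]
    \<comment> \<open>With X = a_y - b_x and Y = f_x - e_y, the first and fourth criteria read X +
      2Y = 3(cd - be) and 2X + Y = 3(cd - be), hence X = Y = cd - be.\<close>
    show "dy a z = dx b z + c z * d z - b z * e z" "dx f z = dy e z + c z * d z - b z * e z"
      using cr(1,4) by simp_all
    show "dy b z = dx c z + b z * b z - b z * f z - a z * c z + c z * e z"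
      "dy d z = dx e z - b z * d z + d z * f z - e z * e z + a z * e z"
      using cr(2,3) by (simp_all add: power2_eq_square algebra_simps)
  qed
  obtain Q s1 t1 s2 t2 where Q: "open Q" "z0 \<in> Q" "Q \<subseteq> R"
    and par: "parallel_form Q a b c d e f s1 t1" "parallel_form Q a b c d e f s2 t2"
    and nz: "\<And>z. z \<in> Q \<Longrightarrow> s1 z * t2 z - t1 z * s2 z \<noteq> 0"
    by (rule parallel_coframe[OF R z0 sm flat metric]) (assumption | rule that)+
  obtain Q1 U where Q1: "open Q1" "z0 \<in> Q1" "Q1 \<subseteq> Q" "smooth_on Q1 U"
    and U: "\<And>z. z \<in> Q1 \<Longrightarrow> has_gradient U (s1 z) (t1 z) z"
    by (rule parallel_form_has_potential[OF Q(1,2) sm[THEN smooth_on_subset, OF Q(3)] par(1)])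
      (assumption | rule that)+
  have Q1R: "Q1 \<subseteq> R"
    using Q1 Q by blast
  obtain Q2 V where Q2: "open Q2" "z0 \<in> Q2" "Q2 \<subseteq> Q1" "smooth_on Q2 V"
    and V: "\<And>z. z \<in> Q2 \<Longrightarrow> has_gradient V (s2 z) (t2 z) z"
    by (rule parallel_form_has_potential[OF Q1(1,2) sm[THEN smooth_on_subset, OF Q1R]
          parallel_form_subset[OF par(2) Q1(3)]]) (assumption | rule that)+
  have U2: "has_gradient U (s1 z) (t1 z) z" and nz2: "s1 z * t2 z - t1 z * s2 z \<noteq> 0" if "z \<in> Q2" for z
    using U nz that Q1(3) Q2(3) by blast+
  have jac: "dx U z * dy V z - dy U z * dx V z \<noteq> 0" if "z \<in> Q2" for z
    using nz2[OF that] has_gradient_dx(2)[OF U2[OF that]] has_gradient_dy(2)[OF U2[OF that]]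
      has_gradient_dx(2)[OF V[OF that]] has_gradient_dy(2)[OF V[OF that]] by simp
  obtain N where N: "z0 \<in> N" "N \<subseteq> Q2" "point_transformation N U V"
    by (rule local_point_transformation[OF Q2(1,2) smooth_on_subset[OF Q1(4) Q2(3)] Q2(4) jac])
      (assumption | rule that)+
  have NQ: "N \<subseteq> Q" "N \<subseteq> R"
    using N(2) Q2(3) Q1(3) Q(3) by blast+
  have "transforms_to N U V (cubic_eq c g h d) (linear_eq (\<lambda>_. 0) (\<lambda>_. 0) (\<lambda>_. 0))"
  proof (rule affine_coordinates_transform)
    show "parallel_form N a b c d e f s1 t1" "parallel_form N a b c d e f s2 t2"
      by (rule parallel_form_subset[OF par(1) NQ(1)], rule parallel_form_subset[OF par(2) NQ(1)])
  qed (use subsetD[OF N(2)] subsetD[OF NQ(2)] U2 V nz2 hg in simp_all)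
  \<comment> \<open>The linear target is v'' = 0; its coefficients are constant, so the whole line
    serves as \<open>J\<close>.\<close>
  moreover have "open_interval (UNIV :: real set)" "U ` N \<subseteq> UNIV"
    by (simp_all add: open_interval_def)
  ultimately show "\<exists>N U V J \<alpha> \<beta> \<gamma>. z0 \<in> N \<and> N \<subseteq> R \<and> point_transformation N U V \<and>
      open_interval J \<and> U ` N \<subseteq> J \<and> smooth_on J \<alpha> \<and> smooth_on J \<beta> \<and> smooth_on J \<gamma> \<and>
      transforms_to N U V (cubic_eq c g h d) (linear_eq \<alpha> \<beta> \<gamma>)"
    using N NQ(2) smooth_on_const[of "UNIV :: real set" 0] by meson
qed

section \<open>Recovering the third order equation from the cubic one\<close>

lemma antiderivative_x_dx:
  assumes R: "open R" and P: "antiderivative_x R B P" and z: "z \<in> R"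
    and d: "\<And>x y. (x, y) \<in> R \<Longrightarrow> d (x, y) = C * P (x, y) + k y"
  shows "dx d z = C * B z"
proof -
  have "((\<lambda>t. P (t, snd z)) has_real_derivative B z) (at (fst z))"
    using P z unfolding antiderivative_x_def by force
  then have "((\<lambda>t. C * P (t, snd z) + k (snd z)) has_real_derivative C * B z) (at (fst z))"
    by (auto intro!: derivative_eq_intros)
  \<comment> \<open>The formula for \<open>d\<close> holds on \<open>R\<close> only; the slice of
    \<open>R\<close> through \<open>z\<close> is open, so it still determines the
    derivative.\<close>
  moreover have "open ((\<lambda>t. (t, snd z)) -` R)"
    by (intro open_vimage[OF R] continuous_intros)
  ultimately have "((\<lambda>t. d (t, snd z)) has_real_derivative C * B z) (at (fst z))"
    by (rule has_field_derivative_transform_within_open) (use z d in auto)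
  then show ?thesis
    unfolding dx_def by (rule DERIV_imp_deriv)
qed

lemma antiderivative_y_dy:
  assumes R: "open R" and P: "antiderivative_y R B P" and z: "z \<in> R"
    and d: "\<And>x y. (x, y) \<in> R \<Longrightarrow> d (x, y) = P (x, y) + k x"
  shows "dy d z = B z"
proof -
  have "((\<lambda>t. P (fst z, t)) has_real_derivative B z) (at (snd z))"
    using P z unfolding antiderivative_y_def by force
  then have "((\<lambda>t. P (fst z, t) + k (fst z)) has_real_derivative B z) (at (snd z))"
    by (auto intro!: derivative_eq_intros)
  moreover have "open ((\<lambda>t. (fst z, t)) -` R)"
    by (intro open_vimage[OF R] continuous_intros)
  ultimately have "((\<lambda>t. d (fst z, t)) has_real_derivative B z) (at (snd z))"
    by (rule has_field_derivative_transform_within_open) (use z d in auto)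
  then show ?thesis
    unfolding dy_def by (rule DERIV_imp_deriv)
qed

lemma cubic_eq_obtained_by_differentiation:
  assumes sm: "smooth_on R c" "smooth_on R g" "smooth_on R h" "smooth_on R d"
    and A: "\<And>z. z \<in> R \<Longrightarrow> A2 z = 3 * c z" "\<And>z. z \<in> R \<Longrightarrow> A1 z = 2 * g z" "\<And>z. z \<in> R \<Longrightarrow> A0 z = h z"
    and B: "\<And>z. z \<in> R \<Longrightarrow> B4 z = dy c z" "\<And>z. z \<in> R \<Longrightarrow> B3 z = dy g z - dx c z"
      "\<And>z. z \<in> R \<Longrightarrow> B2 z = dy h z - dx g z" "\<And>z. z \<in> R \<Longrightarrow> B1 z = dy d z - dx h z"
      "\<And>z. z \<in> R \<Longrightarrow> B0 z = - dx d z"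
  shows "obtained_by_differentiation R (cubic_eq c g h d) (third_order_eq A0 A1 A2 B0 B1 B2 B3 B4)"
  unfolding obtained_by_differentiation_def
proof (intro allI impI ballI)
  fix I y x
  assume y: "times_differentiable_on 3 I y" and graph: "graph_in R I y" and x: "x \<in> I"
  define y1 y2 y3 where "y1 = deriv y" and "y2 = deriv y1" and "y3 = deriv y2"
  have z: "(x, y x) \<in> R"
    using graph x by (simp add: graph_in_def)
  have dy: "(y has_real_derivative y1 x) (at x)" "(y1 has_real_derivative y2 x) (at x)"
    "(y2 has_real_derivative y3 x) (at x)"
    using y x by (simp_all add: times_differentiable_on_3 y1_def y2_def y3_def differentiable_DERIV_deriv)
  have comp: "((\<lambda>t. f (t, y t)) has_real_derivative (dx f (x, y x) + dy f (x, y x) * y1 x)) (at x)"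
    if "smooth_on R f" for f
    using has_gradient_compose_curve[where x = "\<lambda>x. x", OF smooth_on_gradient[OF that z] DERIV_ident dy(1)] by simp
  have "((\<lambda>t. y2 t + c (t, y t) * y1 t ^ 3 - g (t, y t) * y1 t ^ 2 + h (t, y t) * y1 t - d (t, y t))
      has_real_derivative third_order_eq A0 A1 A2 B0 B1 B2 B3 B4 x (y x) (y1 x) (y2 x) (y3 x)) (at x)"
    by (rule DERIV_cong, (rule derivative_intros comp dy sm)+)
      (simp add: third_order_eq_def A[OF z] B[OF z] power2_eq_square power3_eq_cube power4_eq_xxxx algebra_simps)
  then show "((\<lambda>t. cubic_eq c g h d t (y t) (deriv y t) (deriv (deriv y) t)) has_real_derivative
      third_order_eq A0 A1 A2 B0 B1 B2 B3 B4 x (y x) (deriv y x) (deriv (deriv y) x) (deriv (deriv (deriv y)) x)) (at x)"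
    by (simp add: cubic_eq_def y1_def y2_def y3_def)
qed

theorem theorem2:
  fixes R :: "(real \<times> real) set"
    and A0 A1 A2 B0 B1 B2 B3 B4 :: "real \<times> real \<Rightarrow> real"
    and c g h :: "real \<times> real \<Rightarrow> real"
    and d0 P Q :: "real \<times> real \<Rightarrow> real"
    and k l :: "real \<Rightarrow> real"
  assumes region: "open R" "connected R"
    and smooth_A: "smooth_on R A0" "smooth_on R A1" "smooth_on R A2"
    and smooth_B: "smooth_on R B0" "smooth_on R B1" "smooth_on R B2" "smooth_on R B3" "smooth_on R B4"
    and cgh: "\<forall>z\<in>R. c z = A2 z / 3 \<and> g z = A1 z / 2 \<and> h z = A0 z"
    and c_nonzero: "\<forall>z\<in>R. c z \<noteq> 0"
    and constraints:
      "\<forall>z\<in>R. B4 z = dy A2 z / 3"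
      "\<forall>z\<in>R. B3 z = dy A1 z / 2 - dx A2 z / 3"
      "\<forall>z\<in>R. B2 z = dy A0 z - dx A1 z / 2"
    and smooth_d0: "smooth_on R d0"
    and int_x: "antiderivative_x R B0 P" "\<forall>(x, y)\<in>R. d0 (x, y) = - P (x, y) + k y"
    and int_y: "antiderivative_y R (\<lambda>z. B1 z + dx A0 z) Q" "\<forall>(x, y)\<in>R. d0 (x, y) = Q (x, y) + l x"
    and criteria:
      "\<exists>K d a b e f p q r.
         (\<forall>z\<in>R. d z = d0 z + K) \<and>
         smooth_on R a \<and> smooth_on R b \<and> smooth_on R e \<and> smooth_on R f \<and>
         (\<forall>z\<in>R. h z = a z - 2 * e z \<and> g z = f z - 2 * b z) \<and>
         linearizability_criteria R b c d e g h \<and>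
         compatible_metric R a b c d e f p q r"
  shows "linearizable3 R (third_order_eq A0 A1 A2 B0 B1 B2 B3 B4)"
proof -
  obtain K d a b e f p q r where d: "\<forall>z\<in>R. d z = d0 z + K"
    and sm: "smooth_on R a" "smooth_on R b" "smooth_on R e" "smooth_on R f"
    and hg: "\<forall>z\<in>R. h z = a z - 2 * e z \<and> g z = f z - 2 * b z"
    and crit: "linearizability_criteria R b c d e g h"
    and metric: "compatible_metric R a b c d e f p q r"
    using criteria by (elim exE conjE) (rule that)
  note R = region(1)
  have smd: "smooth_on R d"
    by (rule smooth_on_cong[OF R _ smooth_on_add[OF R smooth_d0 smooth_on_const[of R K]]]) (simp add: d)
  have scaled: "has_gradient u (C * dx A z) (C * dy A z) z"
    if "smooth_on R A" "\<And>z. z \<in> R \<Longrightarrow> u z = C * A z" "z \<in> R" for u A C z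
    by (rule has_gradient_cong[OF R that(3) _ has_gradient_cmult[OF smooth_on_gradient[OF that(1,3)]]])
      (simp add: that(2))
  have smooth_scaled: "smooth_on R u"
    if "smooth_on R A" "\<And>z. z \<in> R \<Longrightarrow> u z = C * A z" for u A C
    by (rule smooth_on_cong[OF R _ smooth_on_mult[OF R smooth_on_const[of R C] that(1)]]) (simp add: that(2))
  have c: "c z = 1 / 3 * A2 z" and g: "g z = 1 / 2 * A1 z" and h: "h z = 1 * A0 z" if "z \<in> R" for z
    using cgh that by simp_all
  have smc: "smooth_on R c" and smg: "smooth_on R g" and smh: "smooth_on R h"
    by (rule smooth_scaled[OF smooth_A(3) c] smooth_scaled[OF smooth_A(2) g]
        smooth_scaled[OF smooth_A(1) h]; assumption)+
  have c': "dx c z = 1 / 3 * dx A2 z" "dy c z = 1 / 3 * dy A2 z"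
    and g': "dx g z = 1 / 2 * dx A1 z" "dy g z = 1 / 2 * dy A1 z"
    and h': "dx h z = dx A0 z" "dy h z = dy A0 z" if "z \<in> R" for z
    using has_gradient_dx(2)[OF scaled[OF smooth_A(3) c that]] has_gradient_dy(2)[OF scaled[OF smooth_A(3) c that]]
      has_gradient_dx(2)[OF scaled[OF smooth_A(2) g that]] has_gradient_dy(2)[OF scaled[OF smooth_A(2) g that]]
      has_gradient_dx(2)[OF scaled[OF smooth_A(1) h that]] has_gradient_dy(2)[OF scaled[OF smooth_A(1) h that]]
    by simp_all
  \<comment> \<open>The free constant \<open>K\<close> is absorbed into the function of integration,
    here and in the y-direction.\<close>
  have dxd: "dx d z = - 1 * B0 z" if "z \<in> R" for z
    by (rule antiderivative_x_dx[OF R int_x(1) that, where k = "\<lambda>y. k y + K"]) (use d int_x(2) in auto)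
  have dyd: "dy d z = B1 z + dx A0 z" if "z \<in> R" for z
    by (rule antiderivative_y_dy[OF R int_y(1) that, where k = "\<lambda>x. l x + K"]) (use d int_y(2) in auto)
  have "obtained_by_differentiation R (cubic_eq c g h d) (third_order_eq A0 A1 A2 B0 B1 B2 B3 B4)"
    by (rule cubic_eq_obtained_by_differentiation[OF smc smg smh smd])
      (use constraints in \<open>simp_all add: c g h c' g' h' dxd dyd\<close>)
  moreover have "linearizable2 R (cubic_eq c g h d)"
    by (rule flat_metric_linearizable[OF R sm(1,2) smc smd sm(3,4) _ _ crit metric]) (use hg in auto)
  ultimately show ?thesis
    unfolding linearizable3_def using smc smg smh smd by blast
qed

end
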